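(* Let $\mathrm{C}_n$ be the $n$-cycle. Suppose that at time $0$ there is exactly one walker at each vertex of $\mathrm{C}_n$ and that the walkers perform independent continuous-time simple random walks on $\mathrm{C}_n$ with jump rate $1$. Then there exist absolute constants $c_1,c_2,\alpha,C_1,C_2>0$ (not depending on $n$) such that $$\Pr[\mathrm{SC}(\mathrm{C}_n)>C_1\log^2 n]\le C_2/n ,$$ $$\Pr[\mathrm{SC}(\mathrm{C}_n)<c_1\log^2 n]\le e^{-c_2 n^{\alpha}} .$$
   Context: In a system of independently moving walkers on a graph $G$, two walkers have met by time $t$ if they occupy the same vertex at the same time $t_0$ for some $t_0\le t$; walkers do not interact otherwise. Two walkers $a,b$ have a path of acquaintances by time $t$ if there are walkers $a=c_0,c_1,\dots,c_{k+1}=b$ such that $c_i$ and $c_{i+1}$ have met by time $t$ for every $0\le i\le k$. The social connectivity time $\mathrm{SC}(G)$ is the minimal time $t$ by which every pair of walkers has a path of acquaintances. Continuous-time simple random walk with jump rate $1$: the walker waits independent rate-$1$ exponential times between jumps, and at each jump moves to a uniformly chosen neighbor. *)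

theory Defs
  imports "HOL-Probability.Probability"
begin

text \<open>
  A finite simple graph is given by its vertex set \<open>V\<close> and its symmetric irreflexive edge relation
  \<open>E\<close>; the neighbours of \<open>x\<close> form the set \<open>E `` {x}\<close>.
\<close>

definition cycle_vertices :: "nat \<Rightarrow> nat set" where
  "cycle_vertices n = {..<n}"

definition cycle_edges :: "nat \<Rightarrow> (nat \<times> nat) set" where
  "cycle_edges n = {(x, y). x < n \<and> y < n \<and> (y = Suc x mod n \<or> x = Suc y mod n)}"

text \<open>
  There is one walker per vertex, named after its starting point. The \<open>k\<close>-th step of a walker is
  driven by a pair \<open>(\<tau>, f)\<close>: the walker waits for time \<open>\<tau>\<close> and then jumps from its current vertex
  \<open>x\<close> to \<open>f x\<close>. Here \<open>\<tau>\<close> is exponential with rate 1 and, independently, the \<open>f x\<close> are independent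
  uniformly chosen neighbours of \<open>x\<close>. Only the value of \<open>f\<close> at the current vertex is ever used, and
  \<open>f\<close> is fresh at every step, so each jump goes to a uniform neighbour given the whole past.
\<close>

definition step_law :: "'v set \<Rightarrow> ('v \<times> 'v) set \<Rightarrow> (real \<times> ('v \<Rightarrow> 'v)) measure" where
  "step_law V E =
     density lborel (\<lambda>s. ennreal (exponential_density 1 s))
       \<Otimes>\<^sub>M measure_pmf (Pi_pmf V undefined (\<lambda>x. pmf_of_set (E `` {x})))"

text \<open>The steps of all walkers are independent.\<close>

definition walkers_space ::
    "'v set \<Rightarrow> ('v \<times> 'v) set \<Rightarrow> ('v \<times> nat \<Rightarrow> real \<times> ('v \<Rightarrow> 'v)) measure" where
  "walkers_space V E = (\<Pi>\<^sub>M _\<in>V \<times> UNIV. step_law V E)"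

definition jump_time :: "('v \<times> nat \<Rightarrow> real \<times> ('v \<Rightarrow> 'v)) \<Rightarrow> 'v \<Rightarrow> nat \<Rightarrow> real" where
  "jump_time \<omega> a k = (\<Sum>i<k. fst (\<omega> (a, i)))"

primrec jump_chain :: "('v \<times> nat \<Rightarrow> real \<times> ('v \<Rightarrow> 'v)) \<Rightarrow> 'v \<Rightarrow> nat \<Rightarrow> 'v" where
  "jump_chain \<omega> a 0 = a"
| "jump_chain \<omega> a (Suc k) = snd (\<omega> (a, k)) (jump_chain \<omega> a k)"

text \<open>
  The \<open>LEAST\<close> is the number of jumps made up to time \<open>t\<close>. It is a junk value only if all jump times
  are at most \<open>t\<close>, which happens with probability 0.
\<close>

definition position :: "('v \<times> nat \<Rightarrow> real \<times> ('v \<Rightarrow> 'v)) \<Rightarrow> 'v \<Rightarrow> real \<Rightarrow> 'v" where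
  "position \<omega> a t = jump_chain \<omega> a (LEAST k. t < jump_time \<omega> a (Suc k))"

definition met_by :: "('v \<times> nat \<Rightarrow> real \<times> ('v \<Rightarrow> 'v)) \<Rightarrow> real \<Rightarrow> 'v \<Rightarrow> 'v \<Rightarrow> bool" where
  "met_by \<omega> t a b \<longleftrightarrow> (\<exists>t0. 0 \<le> t0 \<and> t0 \<le> t \<and> position \<omega> a t0 = position \<omega> b t0)"

definition acquaintance_path ::
    "'v set \<Rightarrow> ('v \<times> nat \<Rightarrow> real \<times> ('v \<Rightarrow> 'v)) \<Rightarrow> real \<Rightarrow> 'v \<Rightarrow> 'v \<Rightarrow> bool" where
  "acquaintance_path V \<omega> t a b \<longleftrightarrow>
     (\<exists>k c. c 0 = a \<and> c (Suc k) = b \<and> (\<forall>i\<le>Suc k. c i \<in> V) \<and>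
            (\<forall>i\<le>k. met_by \<omega> t (c i) (c (Suc i))))"

text \<open>
  The infimum is taken in the extended reals, so that the connectivity time is \<open>\<infinity>\<close> if the walkers
  never become connected. When finite it is attained, because positions are right-continuous step
  functions of time.
\<close>

definition social_connectivity_time ::
    "'v set \<Rightarrow> ('v \<times> nat \<Rightarrow> real \<times> ('v \<Rightarrow> 'v)) \<Rightarrow> ereal" where
  "social_connectivity_time V \<omega> =
     Inf (ereal ` {t. 0 \<le> t \<and> (\<forall>a\<in>V. \<forall>b\<in>V. acquaintance_path V \<omega> t a b)})"

text \<open>
  The remaining facts show that \<^const>\<open>walkers_space\<close> is a probability space and that the connectivity
  time is a random variable on it, so that the measure of events about it is meaningful.
\<close>

lemma prob_space_step_law: "prob_space (step_law V E)"
proof -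
  interpret A: prob_space "density lborel (\<lambda>s. ennreal (exponential_density 1 s))"
    by (rule prob_space_exponential_density) simp
  interpret B: prob_space "measure_pmf (Pi_pmf V undefined (\<lambda>x. pmf_of_set (E `` {x})))"
    by (rule measure_pmf.prob_space_axioms)
  interpret P: pair_prob_space "density lborel (\<lambda>s. ennreal (exponential_density 1 s))"
      "measure_pmf (Pi_pmf V undefined (\<lambda>x. pmf_of_set (E `` {x})))" ..
  show ?thesis unfolding step_law_def by (rule P.prob_space_axioms)
qed

lemma prob_space_walkers_space: "prob_space (walkers_space V E)"
  unfolding walkers_space_def by (intro prob_space_PiM prob_space_step_law)

lemma measurable_step:
  assumes "a \<in> V"
  shows "(\<lambda>\<omega>. fst (\<omega> (a, k))) \<in> borel_measurable (walkers_space V E)"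
    and "(\<lambda>\<omega>. snd (\<omega> (a, k))) \<in> walkers_space V E \<rightarrow>\<^sub>M count_space UNIV"
proof -
  have c: "(\<lambda>\<omega>. \<omega> (a, k)) \<in> walkers_space V E \<rightarrow>\<^sub>M step_law V E"
    unfolding walkers_space_def using assms by (intro measurable_component_singleton) auto
  have "fst \<in> step_law V E \<rightarrow>\<^sub>M density lborel (\<lambda>s. ennreal (exponential_density 1 s))"
    unfolding step_law_def by measurable
  from measurable_compose[OF c this]
  show "(\<lambda>\<omega>. fst (\<omega> (a, k))) \<in> borel_measurable (walkers_space V E)" by simp
  have "snd \<in> step_law V E \<rightarrow>\<^sub>M measure_pmf (Pi_pmf V undefined (\<lambda>x. pmf_of_set (E `` {x})))"
    unfolding step_law_def by measurable
  from measurable_compose[OF c this]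
  show "(\<lambda>\<omega>. snd (\<omega> (a, k))) \<in> walkers_space V E \<rightarrow>\<^sub>M count_space UNIV" by simp
qed

lemma measurable_jump_time:
  "a \<in> V \<Longrightarrow> (\<lambda>\<omega>. jump_time \<omega> a k) \<in> borel_measurable (walkers_space V E)"
  unfolding jump_time_def by (intro borel_measurable_sum measurable_step)

lemma measurable_jump_chain:
  fixes a :: "'v :: countable"
  assumes "a \<in> V"
  shows "(\<lambda>\<omega>. jump_chain \<omega> a k) \<in> walkers_space V E \<rightarrow>\<^sub>M count_space UNIV"
proof (induction k)
  case (Suc k)
  have "(\<lambda>\<omega>. snd (\<omega> (a, k)) x) \<in> walkers_space V E \<rightarrow>\<^sub>M count_space UNIV" for x
    by (rule measurable_compose[OF measurable_step(2)[OF assms]]) simp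
  from measurable_compose_countable[OF this Suc] show ?case by simp
qed simp

lemma measurable_position:
  fixes a :: "'v :: countable"
  assumes [simp]: "a \<in> V"
  shows "(\<lambda>\<omega>. position \<omega> a t) \<in> walkers_space V E \<rightarrow>\<^sub>M count_space UNIV"
  unfolding position_def
proof (rule measurable_compose_countable[OF measurable_jump_chain[OF assms]])
  note [measurable] = measurable_jump_time[OF assms]
  show "(\<lambda>\<omega>. LEAST k. t < jump_time \<omega> a (Suc k)) \<in> walkers_space V E \<rightarrow>\<^sub>M count_space UNIV"
    by measurable
qed

lemma position_right_constant:
  "\<exists>d>0. \<forall>s. t \<le> s \<and> s < t + d \<longrightarrow> position \<omega> a s = position \<omega> a t"
proof (cases "\<exists>k. t < jump_time \<omega> a (Suc k)")
  case True
  define K where "K = (LEAST k. t < jump_time \<omega> a (Suc k))"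
  have K: "t < jump_time \<omega> a (Suc K)" unfolding K_def by (rule LeastI_ex[OF True])
  have "(LEAST k. s < jump_time \<omega> a (Suc k)) = K"
    if s: "t \<le> s" "s < t + (jump_time \<omega> a (Suc K) - t)" for s
  proof (rule Least_equality)
    show "s < jump_time \<omega> a (Suc K)" using s by simp
    show "K \<le> k" if "s < jump_time \<omega> a (Suc k)" for k
      unfolding K_def by (rule Least_le) (use that s in simp)
  qed
  then have "\<forall>s. t \<le> s \<and> s < t + (jump_time \<omega> a (Suc K) - t) \<longrightarrow> position \<omega> a s = position \<omega> a t"
    unfolding position_def K_def[symmetric] by metis
  moreover have "jump_time \<omega> a (Suc K) - t > 0" using K by simp
  ultimately show ?thesis by blast
next
  case False
  then have "(\<lambda>k. s < jump_time \<omega> a (Suc k)) = (\<lambda>k. t < jump_time \<omega> a (Suc k))" if "t \<le> s" for s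
    using that by (metis le_less_trans)
  then have "\<forall>s. t \<le> s \<and> s < t + 1 \<longrightarrow> position \<omega> a s = position \<omega> a t"
    unfolding position_def by metis
  then show ?thesis using zero_less_one by blast
qed

lemma met_by_iff_rational:
  assumes "0 \<le> t"
  shows "met_by \<omega> t a b \<longleftrightarrow>
    (\<exists>q\<in>insert t {q\<in>\<rat>. 0 \<le> q \<and> q \<le> t}. position \<omega> a q = position \<omega> b q)"
proof
  assume "met_by \<omega> t a b"
  then obtain t0 where t0: "0 \<le> t0" "t0 \<le> t" "position \<omega> a t0 = position \<omega> b t0"
    unfolding met_by_def by blast
  show "\<exists>q\<in>insert t {q\<in>\<rat>. 0 \<le> q \<and> q \<le> t}. position \<omega> a q = position \<omega> b q"
  proof (cases "t0 = t")
    case False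
    obtain d1 d2 where d: "d1 > 0" "\<forall>s. t0 \<le> s \<and> s < t0 + d1 \<longrightarrow> position \<omega> a s = position \<omega> a t0"
        "d2 > 0" "\<forall>s. t0 \<le> s \<and> s < t0 + d2 \<longrightarrow> position \<omega> b s = position \<omega> b t0"
      using position_right_constant by metis
    have "t0 < min t (t0 + min d1 d2)" using t0(2) False d(1,3) by simp
    then obtain q where q: "q \<in> \<rat>" "t0 < q" "q < min t (t0 + min d1 d2)"
      using Rats_dense_in_real by blast
    have "t0 \<le> q" "q < t0 + d1" "q < t0 + d2" using q by auto
    then have "position \<omega> a q = position \<omega> b q" using d(2,4) t0(3) by metis
    with t0(1) q show ?thesis by (intro bexI[of _ q]) auto
  qed (use t0 in auto)
next
  assume "\<exists>q\<in>insert t {q\<in>\<rat>. 0 \<le> q \<and> q \<le> t}. position \<omega> a q = position \<omega> b q"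
  then show "met_by \<omega> t a b" unfolding met_by_def using assms by auto
qed

lemma measurable_met_by:
  fixes a b :: "'v :: countable"
  assumes "a \<in> V" "b \<in> V" "0 \<le> t"
  shows "Measurable.pred (walkers_space V E) (\<lambda>\<omega>. met_by \<omega> t a b)"
proof -
  have "countable (insert t {q\<in>\<rat>. 0 \<le> q \<and> q \<le> t})"
    using countable_rat by (auto intro: countable_subset[of _ \<rat>])
  moreover note [measurable] = measurable_position[OF assms(1)] measurable_position[OF assms(2)]
  ultimately show ?thesis
    unfolding met_by_iff_rational[OF assms(3)] by measurable
qed

lemma measurable_acquaintance_path:
  fixes V :: "'v :: countable set"
  assumes V: "finite V" and t: "0 \<le> t"
  shows "Measurable.pred (walkers_space V E) (\<lambda>\<omega>. acquaintance_path V \<omega> t a b)"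
proof -
  define R where "R \<omega> = {(x, y). x \<in> V \<and> y \<in> V \<and> met_by \<omega> t x y}" for \<omega>
  define Q where "Q r \<longleftrightarrow> (\<exists>k c. c 0 = a \<and> c (Suc k) = b \<and> (\<forall>i\<le>Suc k. c i \<in> V) \<and>
            (\<forall>i\<le>k. (c i, c (Suc i)) \<in> r))" for r :: "('v \<times> 'v) set"
  have eq: "acquaintance_path V \<omega> t a b \<longleftrightarrow> (\<exists>r\<in>Pow (V \<times> V). Q r \<and> (\<forall>p\<in>V \<times> V. p \<in> r \<longleftrightarrow> met_by \<omega> t (fst p) (snd p)))"
    for \<omega>
  proof -
    have "acquaintance_path V \<omega> t a b \<longleftrightarrow> Q (R \<omega>)"
    proof
      assume "acquaintance_path V \<omega> t a b"
      then obtain k c where "c 0 = a" "c (Suc k) = b" "\<forall>i\<le>Suc k. c i \<in> V"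
        "\<forall>i\<le>k. met_by \<omega> t (c i) (c (Suc i))" unfolding acquaintance_path_def by blast
      then show "Q (R \<omega>)" unfolding Q_def R_def by (intro exI[of _ k] exI[of _ c]) auto
    next
      assume "Q (R \<omega>)"
      then show "acquaintance_path V \<omega> t a b" unfolding Q_def R_def acquaintance_path_def by blast
    qed
    also have "\<dots> \<longleftrightarrow> (\<exists>r\<in>Pow (V \<times> V). Q r \<and> r = R \<omega>)"
      unfolding R_def by auto
    also have "\<dots> \<longleftrightarrow> (\<exists>r\<in>Pow (V \<times> V). Q r \<and> (\<forall>p\<in>V \<times> V. p \<in> r \<longleftrightarrow> met_by \<omega> t (fst p) (snd p)))"
      by (intro bex_cong refl conj_cong) (auto simp: R_def)
    finally show ?thesis .
  qed
  have m: "Measurable.pred (walkers_space V E) (\<lambda>\<omega>. met_by \<omega> t (fst p) (snd p))" if "p \<in> V \<times> V" for p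
    using that t by (intro measurable_met_by) auto
  show ?thesis
    unfolding eq using V
    by (intro pred_intros_finite pred_intros_logic m) auto
qed

lemma acquaintance_path_mono:
  assumes "acquaintance_path V \<omega> s a b" "s \<le> t"
  shows "acquaintance_path V \<omega> t a b"
proof -
  have "met_by \<omega> s x y \<Longrightarrow> met_by \<omega> t x y" for x y
    unfolding met_by_def using assms(2) by (meson order_trans)
  with assms(1) show ?thesis unfolding acquaintance_path_def by blast
qed

lemma measurable_social_connectivity_time:
  fixes V :: "'v :: countable set"
  assumes V: "finite V"
  shows "social_connectivity_time V \<in> borel_measurable (walkers_space V E)"
proof (rule borel_measurableI_less)
  fix y :: ereal
  define C where "C \<omega> t \<longleftrightarrow> (\<forall>a\<in>V. \<forall>b\<in>V. acquaintance_path V \<omega> t a b)" for \<omega> t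
  have eq: "social_connectivity_time V \<omega> < y \<longleftrightarrow> (\<exists>q\<in>{q\<in>\<rat>. 0 \<le> q \<and> ereal q < y}. C \<omega> q)" for \<omega>
  proof -
    have "social_connectivity_time V \<omega> < y \<longleftrightarrow> (\<exists>t. 0 \<le> t \<and> C \<omega> t \<and> ereal t < y)"
      unfolding social_connectivity_time_def C_def by (auto simp: Inf_less_iff)
    also have "\<dots> \<longleftrightarrow> (\<exists>q\<in>{q\<in>\<rat>. 0 \<le> q \<and> ereal q < y}. C \<omega> q)"
    proof
      assume "\<exists>t. 0 \<le> t \<and> C \<omega> t \<and> ereal t < y"
      then obtain t where t: "0 \<le> t" "C \<omega> t" "ereal t < y" by blast
      obtain z where z: "ereal t < ereal z" "ereal z < y" using ereal_dense2[OF t(3)] by blast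
      then obtain q where q: "q \<in> \<rat>" "t < q" "q < z" using Rats_dense_in_real by auto
      have "ereal q < y" using q(3) z(2) by (meson ereal_less(3) less_ereal.simps(1) less_trans)
      moreover have "C \<omega> q" using t(2) q(2) unfolding C_def
        by (meson acquaintance_path_mono less_imp_le)
      ultimately show "\<exists>q\<in>{q\<in>\<rat>. 0 \<le> q \<and> ereal q < y}. C \<omega> q" using q t by force
    qed auto
    finally show ?thesis .
  qed
  have m: "Measurable.pred (walkers_space V E) (\<lambda>\<omega>. C \<omega> q)" if "0 \<le> q" for q
    unfolding C_def using V that
    by (intro pred_intros_finite measurable_acquaintance_path) auto
  have "countable {q\<in>\<rat>. 0 \<le> q \<and> ereal q < y}"
    using countable_rat by (auto intro: countable_subset[of _ \<rat>])
  then have "Measurable.pred (walkers_space V E) (\<lambda>\<omega>. \<exists>q\<in>{q\<in>\<rat>. 0 \<le> q \<and> ereal q < y}. C \<omega> q)"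
    by (rule measurable_pred_countable(2)) (auto intro: m)
  then show "{\<omega> \<in> space (walkers_space V E). social_connectivity_time V \<omega> < y} \<in> sets (walkers_space V E)"
    unfolding eq[symmetric] pred_def .
qed

end

theory Submission
  imports Defs "HOL-Real_Asymp.Real_Asymp"
begin

text \<open>
  Everything happens at times of order \<open>log\<^sup>2 n\<close>, by which a walker has typically travelled a distance
  of order \<open>log n\<close>.

  Connection by time \<open>C\<^sub>1 log\<^sup>2 n\<close>. Fix an edge \<open>{a, a + 1}\<close> and consider the \<open>L\<close> walkers that start at
  \<open>a, a - 1, \<dots>, a - L + 1\<close>, with \<open>L\<close> a multiple of \<open>log n\<close>. A fourth moment argument shows that each of them
  is beyond \<open>a\<close> at time \<open>t\<close> with probability at least \<open>1 / 32\<close> as soon as \<open>32 L\<^sup>2 \<le> t\<close> (\<open>prob_moved\<close>),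
  and the walkers are independent, so some of them is beyond \<open>a\<close> up to an error \<open>(31 / 32)\<^sup>L \<le> n\<^sup>-\<^sup>2\<close>. By
  symmetry, some walker from the other side of the edge has also crossed it. These two walkers have
  exchanged their order; as walkers jump to neighbours and no two of them jump at the same time,
  they have met (\<open>overtaking_meet\<close>). A walker that starts between the two has exchanged its order with at
  least one of them, so all walkers from this stretch are acquainted, in particular those of \<open>a\<close> and
  \<open>a + 1\<close> (\<open>acquainted_across_edge\<close>). A union bound over the \<open>n\<close> edges finishes the argument.

  No connection by time \<open>c\<^sub>1 log\<^sup>2 n\<close>. Call the gap between \<open>c - 1\<close> and \<open>c\<close> a good cut if none of the \<open>2 r\<close>
  walkers that start within distance \<open>r\<close> of it crosses it in time. A walk that starts at distance \<open>k\<close> from the gap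
  avoids it for \<open>w\<^sup>2\<close> steps with probability at least \<open>k / (3 w)\<close> if \<open>k \<le> w\<close>, and up to an error that
  decays exponentially in \<open>k / w\<close> if \<open>k > w\<close>. The product of these probabilities over all \<open>k\<close> is at
  least \<open>exp (-15 w)\<close>, however large \<open>r\<close> is (\<open>prod_stay_prob_ge\<close>). So if \<open>w\<close> is a small multiple of
  \<open>log n\<close>, a given gap is a good cut with probability at least \<open>n powr (-1/4) / 2\<close>. Choosing \<open>r\<close> close to
  \<open>sqrt n\<close> leaves room for of order \<open>sqrt n\<close> disjoint windows, which behave independently; hence both the
  first and the second half of these windows contain a good cut, up to an error \<open>exp (- c n powr (1/4))\<close>. The event that some walker makes
  more than \<open>r\<close> jumps is even less likely, and outside of it two good cuts separate the walkers between them
  from all others (\<open>two_good_cuts_separate\<close>). For the finitely many \<open>n\<close> for which these estimates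
  are void, it is enough that the probability is less than 1: with positive probability nobody moves.

  The two arguments share one reduction. The directions of the jumps of a walker form a uniformly
  distributed list of signs, and they are independent of its waiting times (\<open>prob_waits_moves\<close>), so that
  estimates on random walks become averages over lists of booleans, and the number of jumps is handled
  by the tails of the Poisson distribution.
\<close>

section \<open>Simple random walk as a uniform list of signs\<close>

definition step :: "bool \<Rightarrow> int" where
  "step b = (if b then 1 else - 1)"

definition endpoint :: "bool list \<Rightarrow> int" where
  "endpoint s = sum_list (map step s)"

lemma endpoint_simps [simp]:
  "endpoint [] = 0" "endpoint (b # s) = step b + endpoint s" "endpoint (s @ s') = endpoint s + endpoint s'"
  by (simp_all add: endpoint_def)

lemma endpoint_map_Not: "endpoint (map Not s) = - endpoint s"
  by (induction s) (auto simp: step_def)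

lemma abs_endpoint_le: "\<bar>endpoint s\<bar> \<le> int (length s)"
  by (induction s) (auto simp: step_def)

text \<open>
  The starting point, \<open>j = 0\<close>, counts as a position. So \<open>stays_below k s\<close> fails for \<open>k \<le> 0\<close>, which is the
  absorbing boundary condition that the recursion in \<open>k\<close> needs.
\<close>

definition stays_below :: "int \<Rightarrow> bool list \<Rightarrow> bool" where
  "stays_below k s \<longleftrightarrow> (\<forall>j\<le>length s. endpoint (take j s) < k)"

lemma stays_below_Nil [simp]: "stays_below k [] \<longleftrightarrow> 0 < k"
  by (simp add: stays_below_def)

lemma stays_below_Cons [simp]: "stays_below k (b # s) \<longleftrightarrow> 0 < k \<and> stays_below (k - step b) s"
proof -
  have "(\<forall>j\<le>Suc (length s). endpoint (take j (b # s)) < k) \<longleftrightarrow>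
        0 < k \<and> (\<forall>j\<le>length s. endpoint (take (Suc j) (b # s)) < k)"
    by (metis Suc_le_mono endpoint_simps(1) not0_implies_Suc take0 zero_le)
  also have "\<dots> \<longleftrightarrow> 0 < k \<and> (\<forall>j\<le>length s. endpoint (take j s) < k - step b)"
    by (auto simp: algebra_simps)
  finally show ?thesis by (simp add: stays_below_def)
qed

text \<open>
  Expectation under the uniform distribution on sign lists of length \<open>m\<close>, that is, under simple random
  walk with \<open>m\<close> steps. Splitting off the first step (\<open>avg_Suc\<close>) lets estimates be proved by induction on \<open>m\<close>.
\<close>

definition avg :: "nat \<Rightarrow> (bool list \<Rightarrow> real) \<Rightarrow> real" where
  "avg m f = (\<Sum>s | length s = m. f s) / 2 ^ m"

lemma finite_lists_length [simp]: "finite {s :: bool list. length s = m}"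
  using finite_lists_length_eq[of "UNIV :: bool set" m] by simp

lemma avg_0 [simp]: "avg 0 f = f []"
  by (simp add: avg_def)

lemma avg_Suc: "avg (Suc m) f = (avg m (\<lambda>s. f (True # s)) + avg m (\<lambda>s. f (False # s))) / 2"
proof -
  have "{s :: bool list. length s = Suc m} =
      Cons True ` {s. length s = m} \<union> Cons False ` {s. length s = m}"
    by (auto simp: length_Suc_conv image_iff)
  then have "(\<Sum>s | length s = Suc m. f s) =
      (\<Sum>s\<in>Cons True ` {s. length s = m}. f s) + (\<Sum>s\<in>Cons False ` {s. length s = m}. f s)"
    by (subst sum.union_disjoint[symmetric]) auto
  also have "\<dots> = (\<Sum>s | length s = m. f (True # s)) + (\<Sum>s | length s = m. f (False # s))"
    by (simp add: sum.reindex inj_on_def)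
  finally show ?thesis by (simp add: avg_def field_simps)
qed

lemma avg_add: "avg m (\<lambda>s. f s + g s) = avg m f + avg m g"
  by (simp add: avg_def sum.distrib add_divide_distrib)

lemma avg_cmult: "avg m (\<lambda>s. c * f s) = c * avg m f"
  by (simp add: avg_def sum_distrib_left)

lemma avg_const [simp]: "avg m (\<lambda>s. c) = c"
  by (induction m) (auto simp: avg_Suc)

lemma avg_mono: "(\<And>s. length s = m \<Longrightarrow> f s \<le> g s) \<Longrightarrow> avg m f \<le> avg m g"
  unfolding avg_def by (intro divide_right_mono sum_mono) auto

lemma avg_map_Not: "avg m (\<lambda>s. f (map Not s)) = avg m f"
proof (induction m arbitrary: f)
  case (Suc m)
  show ?case using Suc[of "\<lambda>s. f (True # s)"] Suc[of "\<lambda>s. f (False # s)"] by (simp add: avg_Suc)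
qed simp

lemma avg_endpoint_power2: "avg m (\<lambda>s. (x + real_of_int (endpoint s))\<^sup>2) = x\<^sup>2 + m"
proof (induction m arbitrary: x)
  case (Suc m)
  show ?case using Suc[of "x + 1"] Suc[of "x - 1"]
    by (simp add: avg_Suc step_def algebra_simps power2_eq_square)
qed simp

text \<open>
  The starting point \<open>x\<close> is general because the first step moves it.
\<close>

lemma avg_endpoint_power4:
  "avg m (\<lambda>s. (x + real_of_int (endpoint s)) ^ 4) = x ^ 4 + 6 * m * x\<^sup>2 + 3 * (real m)\<^sup>2 - 2 * m"
proof (induction m arbitrary: x)
  case (Suc m)
  have *: "avg m (\<lambda>s. (x + (1 + real_of_int (endpoint s))) ^ 4) =
       (x + 1) ^ 4 + 6 * m * (x + 1)\<^sup>2 + 3 * (real m)\<^sup>2 - 2 * m"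
     "avg m (\<lambda>s. (x + (real_of_int (endpoint s) - 1)) ^ 4) =
       (x - 1) ^ 4 + 6 * m * (x - 1)\<^sup>2 + 3 * (real m)\<^sup>2 - 2 * m"
    using Suc[of "x + 1"] Suc[of "x - 1"] by (simp_all add: algebra_simps)
  show ?case
    by (simp add: avg_Suc step_def *) (simp add: algebra_simps power2_eq_square power4_eq_xxxx)
qed simp

text \<open>
  By symmetry it suffices that \<open>\<bar>S\<bar> \<ge> d\<close> has probability at least \<open>1 / 8\<close> for the endpoint \<open>S\<close>. The indicator of
  this event dominates \<open>(S\<^sup>2 - d\<^sup>2) (4 m - S\<^sup>2) / (4 m\<^sup>2)\<close>: the product is nonpositive for \<open>\<bar>S\<bar> < d\<close>, and at most
  \<open>(4 m - d\<^sup>2)\<^sup>2 / 4 \<le> 4 m\<^sup>2\<close> everywhere. Its mean is explicit from the second and the fourth moment.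
\<close>

lemma srw_endpoint_ge:
  assumes d: "1 \<le> d" "8 * d\<^sup>2 \<le> m"
  shows "avg m (\<lambda>s. of_bool (int d \<le> endpoint s)) \<ge> 1 / 16"
proof -
  have m: "real m > 0" using d by (cases m) auto
  define D where "D = (real d)\<^sup>2"
  have D: "0 \<le> D" by (simp add: D_def)
  have "real (8 * d\<^sup>2) \<le> real m" using d(2) by (simp only: of_nat_le_iff)
  then have D: "0 \<le> D" "8 * D \<le> m" unfolding D_def by simp_all
  let ?I = "\<lambda>s. of_bool (int d \<le> endpoint s) :: real"
  let ?I' = "\<lambda>s. of_bool (int d \<le> endpoint (map Not s)) :: real"
  have sym: "avg m ?I' = avg m ?I"
    by (rule avg_map_Not)
  let ?p = "\<lambda>s. (1 / (4 * (real m)\<^sup>2)) * ((4 * real m + D) * real_of_int (endpoint s) ^ 2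
       + ((-1) * real_of_int (endpoint s) ^ 4 + (- 4 * real m * D)))"
  have poly: "?p s \<le> ?I s + ?I' s" (is "?L \<le> _") for s
  proof -
    define y where "y = (real_of_int (endpoint s))\<^sup>2"
    have y4: "real_of_int (endpoint s) ^ 4 = y * y" by (simp add: y_def power2_eq_square power4_eq_xxxx)
    have L: "?L = (y - D) * (4 * m - y) / (4 * (real m)\<^sup>2)"
      by (simp add: y4 y_def[symmetric] field_simps)
    show ?thesis
    proof (cases "int d \<le> \<bar>endpoint s\<bar>")
      case True
      then have one: "1 \<le> ?I s + ?I' s" by (auto simp: endpoint_map_Not)
      have "(y - D) * (4 * m - y) \<le> 4 * (real m)\<^sup>2"
      proof -
        have "4 * ((y - D) * (4 * m - y)) \<le> (4 * m - D)\<^sup>2"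
          using zero_le_power2[of "(y - D) - (4 * m - y)"] by (simp add: power2_eq_square algebra_simps)
        also have "\<dots> \<le> (4 * real m)\<^sup>2" using D m by (intro power_mono) auto
        finally show ?thesis by (simp add: power2_eq_square)
      qed
      then have "?L \<le> 1" unfolding L using m by (simp add: divide_le_eq)
      with one show ?thesis by linarith
    next
      case False
      then have "y \<le> D" unfolding y_def D_def
        by (metis abs_le_square_iff abs_of_nat linorder_not_le of_int_abs of_int_less_iff of_int_of_nat_eq order_less_imp_le)
      then have "(y - D) * (4 * m - y) \<le> 0" using D m
        by (intro mult_nonpos_nonneg) auto
      then have "?L \<le> 0" unfolding L by (simp add: divide_le_0_iff)
      then show ?thesis by (smt (verit) of_bool_eq(1) zero_le_one zero_less_one of_bool_def)
    qed
  qed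
  have "avg m ?p \<le> avg m (\<lambda>s. ?I s + ?I' s)"
    by (intro avg_mono poly)
  then have upper: "(1 / (4 * (real m)\<^sup>2)) * ((4 * real m + D) * m + ((-1) * (3 * (real m)\<^sup>2 - 2 * real m) + (- 4 * real m * D))) \<le> 2 * avg m ?I"
    unfolding avg_add avg_cmult avg_const sym
    using avg_endpoint_power2[of m 0] avg_endpoint_power4[of m 0] by simp
  have lower: "(1 / (4 * (real m)\<^sup>2)) * ((4 * real m + D) * m + ((-1) * (3 * (real m)\<^sup>2 - 2 * real m) + (- 4 * real m * D))) \<ge> 1/8"
  proof -
    have "real m * (8 * D) \<le> real m * m" using D m by (intro mult_left_mono) auto
    moreover have "M / 2 \<le> M + 2 * x - 3 / 8 * A" if "A \<le> M" "0 < x" "0 \<le> M" for A M x :: real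
      using that by simp
    ultimately have lin: "real m * m / 2 \<le> real m * m + 2 * real m - 3 / 8 * (real m * (8 * D))"
      using m by (metis mult_nonneg_nonneg less_imp_le)
    have eq: "(4 * real m + D) * m + ((-1) * (3 * (real m)\<^sup>2 - 2 * real m) + (- 4 * real m * D)) =
        real m * m + 2 * real m - 3 / 8 * (real m * (8 * D))"
      by (simp add: algebra_simps power2_eq_square)
    have "(real m)\<^sup>2 / 2 \<le> (4 * real m + D) * m + ((-1) * (3 * (real m)\<^sup>2 - 2 * real m) + (- 4 * real m * D))"
      unfolding eq unfolding power2_eq_square by (rule lin)
    then have le: "(1 / (4 * (real m)\<^sup>2)) * ((real m)\<^sup>2 / 2) \<le>
      (1 / (4 * (real m)\<^sup>2)) * ((4 * real m + D) * m + ((-1) * (3 * (real m)\<^sup>2 - 2 * real m) + (- 4 * real m * D)))"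
      by (intro mult_left_mono) auto
    have "(1 / (4 * (real m)\<^sup>2)) * ((real m)\<^sup>2 / 2) = 1 / 8" using m by (simp add: field_simps)
    with le show ?thesis by (simp only:)
  qed
  have "1 / 8 \<le> 2 * avg m ?I" by (rule order_trans[OF lower upper])
  then show ?thesis by simp
qed

text \<open>
  Reflection of a walk, so that walkers to the left and to the right of an edge can be treated together.
\<close>

definition orient :: "bool \<Rightarrow> bool list \<Rightarrow> bool list" where
  "orient b s = (if b then s else map Not s)"

lemma avg_orient: "avg m (\<lambda>s. f (orient b s)) = avg m f"
  by (cases b) (simp_all add: orient_def avg_map_Not)

lemma endpoint_orient: "endpoint (orient b s) = (if b then endpoint s else - endpoint s)"
  by (simp add: orient_def endpoint_map_Not)

section \<open>Survival of a random walk below a level\<close>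

definition stay_prob :: "nat \<Rightarrow> int \<Rightarrow> real" where
  "stay_prob m k = avg m (\<lambda>s. of_bool (stays_below k s))"

lemma stay_prob_0: "stay_prob 0 k = of_bool (0 < k)"
  by (simp add: stay_prob_def)

lemma stay_prob_Suc:
  "stay_prob (Suc m) k = (if 0 < k then (stay_prob m (k - 1) + stay_prob m (k + 1)) / 2 else 0)"
  by (simp add: stay_prob_def avg_Suc step_def)

lemma stay_prob_nonneg: "0 \<le> stay_prob m k"
  by (simp add: stay_prob_def avg_def sum_nonneg)

text \<open>
  Discrete comparison principle: \<open>stay_prob\<close> solves the discrete heat equation on the positive half line with
  absorption at 0 and initial value 1, so it dominates every subsolution.
\<close>

lemma stay_prob_ge_subsolution:
  fixes g :: "nat \<Rightarrow> int \<Rightarrow> real"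
  assumes 0: "\<And>k. 0 < k \<Longrightarrow> g 0 k \<le> 1"
    and neg: "\<And>m k. k \<le> 0 \<Longrightarrow> g m k \<le> 0"
    and Suc: "\<And>m k. 0 < k \<Longrightarrow> g (Suc m) k \<le> (g m (k - 1) + g m (k + 1)) / 2"
  shows "g m k \<le> stay_prob m k"
proof (induction m arbitrary: k)
  case 0
  then show ?case using assms(1,2) by (auto simp: stay_prob_0 not_less)
next
  case (Suc m)
  show ?case
    using Suc[of "k - 1"] Suc[of "k + 1"] assms(3)[of k m] neg[of k "Suc m"]
    by (auto simp: stay_prob_Suc not_less)
qed

text \<open>
  The polynomials \<open>k\<close> and \<open>k\<^sup>3 + 3 k m\<close> solve the heat equation exactly and vanish at \<open>k = 0\<close>. The
  coefficients of the combination \<open>a k - b (k\<^sup>3 + 3 k m)\<close> keep it below 1 at time 0 for all \<open>k\<close>, while at time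
  \<open>w\<^sup>2\<close> the linear term still dominates for \<open>k \<le> w\<close>.
\<close>

lemma stay_prob_ge_linear:
  assumes w: "1 \<le> w" and k: "1 \<le> k" "k \<le> w"
  shows "stay_prob (w\<^sup>2) (int k) \<ge> k / (3 * w)"
proof -
  define a where "a = 1 / real w"
  define b where "b = a / (6 * (real w)\<^sup>2)"
  have ab: "0 < a" "0 < b" using w by (auto simp: a_def b_def)
  define g where "g m k = (if 0 < k then a * k - b * (real_of_int k ^ 3 + 3 * real_of_int k * real m) else 0)"
    for m :: nat and k :: int
  have "g (w\<^sup>2) (int k) \<le> stay_prob (w\<^sup>2) (int k)"
  proof (rule stay_prob_ge_subsolution)
    fix k :: int assume k: "0 < k"
    define y where "y = real_of_int k / w"
    have y: "0 < y" using k w by (simp add: y_def)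
    have kk: "real_of_int k = y * w" using w by (simp add: y_def)
    have "g 0 k = y - y ^ 3 / 6"
      using k w unfolding g_def a_def b_def kk by (simp add: field_simps power2_eq_square power3_eq_cube)
    also have "\<dots> \<le> 1"
    proof -
      \<comment> \<open>a tangent line of the cubic, taken at \<open>y = 3/2\<close>\<close>
      have "0 \<le> (y - 3/2)\<^sup>2 * (y + 3)" using y by simp
      also have "\<dots> = y ^ 3 - 27/4 * y + 27/4" by (simp add: power2_eq_square power3_eq_cube field_simps)
      finally show ?thesis using y zero_less_power[OF y, of 3] by (cases "y \<le> 1") linarith+
    qed
    finally show "g 0 k \<le> 1" .
  next
    fix m :: nat and k :: int assume k: "0 < k"
    show "g (Suc m) k \<le> (g m (k - 1) + g m (k + 1)) / 2"
    proof -
      have formula: "g m j = a * j - b * (real_of_int j ^ 3 + 3 * real_of_int j * real m)" if "0 \<le> j" for m j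
        using that by (cases "j = 0") (auto simp: g_def)
      show ?thesis using k by (simp add: formula) (simp add: field_simps power3_eq_cube)
    qed
  qed (simp add: g_def)
  moreover have "g (w\<^sup>2) (int k) \<ge> k / (3 * w)"
  proof -
    have "real k ^ 2 \<le> real w ^ 2" using k by (intro power_mono) auto
    then have "real k * real k ^ 2 \<le> real k * real w ^ 2" by (intro mult_left_mono) auto
    then show ?thesis using k w by (simp add: g_def a_def b_def field_simps power2_eq_square power3_eq_cube)
  qed
  ultimately show ?thesis by linarith
qed


text \<open>
  The subsolution is \<open>1 - exp (l\<^sup>2 m - l k)\<close>, because \<open>cosh l \<le> exp (l\<^sup>2)\<close> for \<open>l \<le> 1\<close>. Taking \<open>l = 1 / (2 w)\<close> makes
  the first exponent \<open>1 / 4\<close> at time \<open>w\<^sup>2\<close>; the bound then already has content at \<open>k = w\<close>, where the linear bound ends.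
\<close>

lemma stay_prob_ge_exponential:
  assumes w: "1 \<le> w"
  shows "stay_prob (w\<^sup>2) k \<ge> 1 - exp (1 / 4 - k / (2 * w))"
proof -
  define l where "l = 1 / (2 * real w)"
  have l: "0 < l" "l \<le> 1" using w by (auto simp: l_def field_simps)
  define g where "g m j = 1 - exp (l\<^sup>2 * real m - l * real_of_int j)" for m j
  have "g (w\<^sup>2) k \<le> stay_prob (w\<^sup>2) k"
  proof (rule stay_prob_ge_subsolution)
    fix m :: nat and k :: int
    have "exp l \<le> 1 + l + l\<^sup>2" using l by (intro exp_bound) auto
    moreover have "exp (- l) \<le> 1 - l + l\<^sup>2"
    proof -
      have "exp (- l) = inverse (exp l)" by (simp add: exp_minus)
      also have "\<dots> \<le> inverse (1 + l)" using l by (intro le_imp_inverse_le) auto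
      also have "\<dots> \<le> 1 - l + l\<^sup>2"
      proof -
        have "1 \<le> (1 - l + l\<^sup>2) * (1 + l)"
          using l by (simp add: algebra_simps power2_eq_square)
        then show ?thesis using l by (simp add: field_simps)
      qed
      finally show ?thesis .
    qed
    ultimately have "(exp l + exp (- l)) / 2 \<le> 1 + l\<^sup>2" by simp
    also have "\<dots> \<le> exp (l\<^sup>2)" by (rule exp_ge_add_one_self)
    finally have E: "exp (l\<^sup>2 * m - l * k) * ((exp l + exp (- l)) / 2) \<le> exp (l\<^sup>2 * m - l * k) * exp (l\<^sup>2)"
      by (intro mult_left_mono) auto
    show "g (Suc m) k \<le> (g m (k - 1) + g m (k + 1)) / 2"
    proof -
      define E where "E = exp (l\<^sup>2 * m - l * k)"
      have "g (Suc m) k = 1 - E * exp (l\<^sup>2)" "g m (k - 1) = 1 - E * exp l" "g m (k + 1) = 1 - E * exp (- l)"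
        unfolding g_def E_def by (simp_all add: algebra_simps flip: exp_add)
      with E[folded E_def] show ?thesis by (simp add: algebra_simps)
    qed
  next
    fix m :: nat and k :: int assume "k \<le> 0"
    then have "l * k \<le> 0" using l by (simp add: mult_nonneg_nonpos)
    moreover have "0 \<le> l\<^sup>2 * m" by simp
    ultimately have "0 \<le> l\<^sup>2 * m - l * k" by linarith
    then show "g m k \<le> 0" by (simp add: g_def)
  qed (use l in \<open>simp add: g_def\<close>)
  moreover have "l\<^sup>2 * real (w\<^sup>2) - l * k = 1 / 4 - k / (2 * w)"
    using w by (simp add: l_def field_simps power2_eq_square)
  ultimately show ?thesis by (simp add: g_def)
qed

lemma exp_ge_partial_sum:
  assumes "0 \<le> (x :: real)"
  shows "(\<Sum>n<k. x ^ n / fact n) \<le> exp x"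
proof -
  have "(\<lambda>n. x ^ n / fact n) sums exp x" using exp_converges[of x] by (simp add: divide_inverse mult.commute)
  then show ?thesis
    using sum_le_suminf[of "\<lambda>n. x ^ n / fact n" "{..<k}"] assms by (simp add: sums_iff)
qed

text \<open>
  A crude form of Stirling's lower bound for \<open>w!\<close>: \<open>w\<^sup>w / w!\<close> is one of the terms of the exponential series.
\<close>

lemma power_le_fact_mult_exp: "real w ^ w \<le> fact w * exp (real w)"
proof -
  have "real w ^ w / fact w \<le> (\<Sum>n<Suc w. real w ^ n / fact n)" by (rule member_le_sum) auto
  also have "\<dots> \<le> exp (real w)" by (rule exp_ge_partial_sum) simp
  finally show ?thesis by (simp add: field_simps)
qed

text \<open>
  The factors with \<open>k \<le> w\<close> contribute \<open>w! / (3 w)\<^sup>w \<ge> exp (-3 w)\<close>. A factor \<open>1 - q k\<close> with \<open>k > w\<close> is at least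
  \<open>exp (-5 q k)\<close>, as \<open>q k \<le> 4 / 5\<close>, and the \<open>q k\<close> form a geometric series of sum at most \<open>12 w / 5\<close>. That the bound
  does not depend on \<open>r\<close> allows windows that are much wider than \<open>w\<close>.
\<close>

lemma prod_stay_prob_ge:
  assumes w: "1 \<le> w"
  shows "(\<Prod>k=1..r. stay_prob (w\<^sup>2) (int k)) \<ge> exp (- 15 * real w)"
proof -
  define q where "q k = exp (1 / 4 - k / (2 * w))" for k :: nat
  define low where "low k = (if k \<le> w then k / (3 * real w) else exp (- 5 * q k))" for k
  have low0: "0 \<le> low k" for k by (simp add: low_def)
  have low1: "low k \<le> 1" for k using w by (auto simp: low_def q_def)
  have e14: "exp (1 / 4 :: real) \<ge> 5 / 4" using exp_ge_add_one_self[of "1/4"] by simp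
  have e14': "exp (- (1 / 4) :: real) \<le> 4 / 5"
    using le_imp_inverse_le[OF e14] by (simp add: exp_minus)
  have low: "low k \<le> stay_prob (w\<^sup>2) (int k)" if "1 \<le> k" for k
  proof (cases "k \<le> w")
    case True
    then show ?thesis using stay_prob_ge_linear[OF w that] by (simp add: low_def)
  next
    case False
    have "q k \<le> exp (- (1 / 4))" using False w unfolding q_def by (simp add: field_simps)
    with e14' have q: "q k \<le> 4 / 5" by linarith
    have "0 < q k" by (simp add: q_def)
    note q = q this
    \<comment> \<open>this is where \<open>q k \<le> 4 / 5\<close> enters: \<open>(1 - q) (1 + 5 q) \<ge> 1\<close>\<close>
    have "exp (- 5 * q k) \<le> inverse (1 + 5 * q k)"
      unfolding exp_minus mult_minus_left using exp_ge_add_one_self[of "5 * q k"] q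
      by (intro le_imp_inverse_le) auto
    also have "\<dots> \<le> 1 - q k"
    proof -
      have "0 \<le> q k * (4 / 5 - q k)" using q by simp
      then have "1 \<le> (1 - q k) * (1 + 5 * q k)" by (simp add: algebra_simps)
      then show ?thesis using q by (simp add: field_simps)
    qed
    also have "\<dots> \<le> stay_prob (w\<^sup>2) (int k)"
      using stay_prob_ge_exponential[OF w, of "int k"] by (simp add: q_def)
    finally show ?thesis using False by (simp add: low_def)
  qed
  have "exp (- 15 * real w) \<le> exp (- 3 * real w) * exp (- 12 * real w)"
    by (simp flip: exp_add)
  also have "\<dots> \<le> (\<Prod>k=1..w. k / (3 * real w)) * exp (- 5 * (\<Sum>k=w+1..w+r. q k))"
  proof (rule mult_mono)
    have "(\<Prod>k=1..w. k / (3 * real w)) = fact w / (3 * real w) ^ w"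
      by (simp add: prod_dividef fact_prod)
    moreover have "exp (- 3 * real w) \<le> fact w / (3 * real w) ^ w"
    proof -
      have "(3 * real w) ^ w = 3 ^ w * real w ^ w" by (simp add: power_mult_distrib)
      also have "\<dots> \<le> exp 2 ^ w * (fact w * exp (real w))"
        using exp_ge_add_one_self[of "2::real"] by (intro mult_mono power_le_fact_mult_exp power_mono) auto
      also have "\<dots> = fact w * exp (3 * real w)"
        by (simp flip: exp_of_nat_mult exp_add add: algebra_simps)
      finally show ?thesis using w by (simp add: exp_minus field_simps)
    qed
    ultimately show "exp (- 3 * real w) \<le> (\<Prod>k=1..w. k / (3 * real w))" by simp
    define x where "x = exp (- (1 / (2 * real w)))"
    have x: "0 < x" "x < 1" using w by (auto simp: x_def)
    have x1: "1 - x \<ge> 1 / (3 * real w)"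
    proof -
      have "x \<le> inverse (1 + 1 / (2 * real w))"
        unfolding x_def exp_minus using w by (intro le_imp_inverse_le exp_ge_add_one_self) (simp add: add_pos_nonneg)
      also have "\<dots> = 1 - 1 / (2 * real w + 1)" using w by (simp add: field_simps)
      also have "\<dots> \<le> 1 - 1 / (3 * real w)" using w by (simp add: field_simps)
      finally show ?thesis by simp
    qed
    have q: "q k = exp (1/4) * x ^ k" for k
      unfolding q_def x_def by (simp flip: exp_of_nat_mult exp_add)
    have "(\<Sum>k=w+1..w+r. q k) = exp (1/4) * (\<Sum>k=w+1..w+r. x ^ k)"
      unfolding q by (simp add: sum_distrib_left)
    also have "(\<Sum>k=w+1..w+r. x ^ k) \<le> x ^ w / (1 - x)"
    proof -
      have "(\<Sum>k=w+1..w+r. x ^ k) * (1 - x) \<le> x ^ w"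
      proof (induction r)
        case (Suc r)
        have eq: "(\<Sum>k=w+1..w+r. x ^ k) * (1 - x) = x ^ (w + 1) - x ^ (w + r + 1)" for r
        proof (induction r)
          case (Suc r)
          have "(\<Sum>k=w+1..w+Suc r. x ^ k) = (\<Sum>k=w+1..w+r. x ^ k) + x ^ (w + r + 1)" by simp
          then show ?case by (simp only: Suc.IH distrib_right) (simp add: algebra_simps)
        qed simp
        have "x ^ (w + 1) \<le> x ^ w" using x by (intro power_decreasing) auto
        then show ?case unfolding eq using zero_less_power[OF x(1)] by (smt (verit))
      qed (use x in simp)
      then show ?thesis using x by (simp add: field_simps)
    qed
    also have "x ^ w = exp (- (1 / 2))" using w unfolding x_def by (simp flip: exp_of_nat_mult)
    also have "exp (- (1 / 2)) / (1 - x) \<le> exp (- (1/2)) / (1 / (3 * real w))"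
      using x1 x w by (intro divide_left_mono) auto
    finally have "(\<Sum>k=w+1..w+r. q k) \<le> exp (1/4) * (exp (- (1/2)) / (1 / (3 * real w)))" by simp
    also have "\<dots> = exp (- (1 / 4)) * (3 * real w)" by (simp flip: exp_add mult.assoc)
    also have "\<dots> \<le> 4 / 5 * (3 * real w)" using e14' by (intro mult_right_mono) auto
    finally show "exp (- 12 * real w) \<le> exp (- 5 * (\<Sum>k=w+1..w+r. q k))" by simp
  qed (auto intro!: prod_nonneg)
  also have "\<dots> = (\<Prod>k=1..w. low k) * (\<Prod>k=w+1..w+r. low k)"
    by (simp add: low_def exp_sum sum_distrib_left)
  also have "\<dots> = (\<Prod>k=1..w+r. low k)"
    by (subst prod.ub_add_nat[symmetric]) auto
  also have "\<dots> = (\<Prod>k=1..r. low k) * (\<Prod>k=r+1..r+w. low k)"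
    by (subst add.commute[of w], rule prod.ub_add_nat) auto
  also have "\<dots> \<le> (\<Prod>k=1..r. low k)"
    using low0 low1 by (intro mult_left_le prod_le_1 prod_nonneg) auto
  also have "\<dots> \<le> (\<Prod>k=1..r. stay_prob (w\<^sup>2) (int k))"
    using low low0 by (intro prod_mono) auto
  finally show ?thesis .
qed

section \<open>Poisson tails\<close>

text \<open>
  Chernoff bound with base 2: for \<open>n \<ge> k\<close> the term \<open>t\<^sup>n / n!\<close> is at most \<open>(2 t)\<^sup>n / n!\<close> divided by \<open>2\<^sup>k\<close>.
\<close>

lemma poisson_upper_tail:
  assumes t: "0 \<le> (t :: real)"
  shows "1 - (\<Sum>n<k. t ^ n * exp (- t) / fact n) \<le> exp t / 2 ^ k"
proof -
  \<comment> \<open>comparing termwise through the difference avoids shifting the exponential series\<close>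
  define d where "d n = (1 / 2 ^ k) * ((2 * t) ^ n / fact n) - t ^ n / fact n" for n
  have e: "(\<lambda>n. x ^ n / fact n) sums exp x" for x :: real
    using exp_converges[of x] by (simp add: divide_inverse mult.commute)
  have d: "d sums ((1 / 2 ^ k) * exp (2 * t) - exp t)"
    unfolding d_def by (intro sums_diff sums_mult e)
  have "0 \<le> d n" if "k \<le> n" for n
  proof -
    have "(2 :: real) ^ k \<le> 2 ^ n" using that by (intro power_increasing) auto
    then have "2 ^ k * t ^ n \<le> 2 ^ n * t ^ n" using t by (intro mult_right_mono) auto
    then show ?thesis by (simp add: d_def power_mult_distrib field_simps)
  qed
  then have "(\<Sum>n<k. d n) \<le> (1 / 2 ^ k) * exp (2 * t) - exp t"
    using sum_le_suminf[of d "{..<k}"] d by (auto simp: sums_iff)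
  moreover have "- (\<Sum>n<k. t ^ n / fact n) \<le> (\<Sum>n<k. d n)"
    unfolding sum_negf[symmetric] d_def using t by (intro sum_mono) auto
  ultimately have "exp t - (\<Sum>n<k. t ^ n / fact n) \<le> exp (2 * t) / 2 ^ k" by simp
  then have "exp (- t) * (exp t - (\<Sum>n<k. t ^ n / fact n)) \<le> exp (- t) * (exp (2 * t) / 2 ^ k)"
    by (intro mult_left_mono) auto
  then show ?thesis
    by (simp add: right_diff_distrib sum_distrib_left mult.commute flip: exp_add)
qed

text \<open>
  Chernoff bound with base \<open>1 / 2\<close>.
\<close>

lemma poisson_lower_tail:
  assumes t: "0 \<le> (t :: real)"
  shows "(\<Sum>n<m. t ^ n * exp (- t) / fact n) \<le> 2 ^ m * exp (- t / 2)"
proof -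
  have "(\<Sum>n<m. t ^ n * exp (- t) / fact n) \<le> (\<Sum>n<m. 2 ^ m * exp (- t) * ((t / 2) ^ n / fact n))"
  proof (rule sum_mono)
    fix n assume "n \<in> {..<m}"
    then have "(2 :: real) ^ n \<le> 2 ^ m" by (intro power_increasing) auto
    then have "2 ^ n * (t ^ n * exp (- t)) \<le> 2 ^ m * (t ^ n * exp (- t))" using t by (intro mult_right_mono) auto
    then show "t ^ n * exp (- t) / fact n \<le> 2 ^ m * exp (- t) * ((t / 2) ^ n / fact n)"
      by (simp add: power_divide field_simps)
  qed
  also have "\<dots> = 2 ^ m * exp (- t) * (\<Sum>n<m. (t / 2) ^ n / fact n)" by (simp add: sum_distrib_left)
  also have "\<dots> \<le> 2 ^ m * exp (- t) * exp (t / 2)" using t by (intro mult_left_mono exp_ge_partial_sum) auto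
  also have "\<dots> = 2 ^ m * exp (- t / 2)" by (simp flip: exp_add)
  finally show ?thesis .
qed

section \<open>Independence of disjoint sets of walkers\<close>

lemma sets_step_law: "sets (step_law A E) = sets (borel \<Otimes>\<^sub>M count_space UNIV)"
  unfolding step_law_def by (intro sets_pair_measure_cong) auto

locale cycle_walkers =
  fixes n :: nat
  assumes n_ge_3: "3 \<le> n"
begin

abbreviation V where "V \<equiv> cycle_vertices n"
abbreviation E where "E \<equiv> cycle_edges n"
abbreviation M where "M \<equiv> walkers_space V E"
abbreviation step_measure where "step_measure \<equiv> step_law V E"
abbreviation wait_measure where "wait_measure \<equiv> density lborel (\<lambda>s. ennreal (exponential_density 1 s))"
abbreviation choice_pmf where "choice_pmf \<equiv> Pi_pmf V undefined (\<lambda>x. pmf_of_set (E `` {x}))"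

sublocale prob_space M
  by (rule prob_space_walkers_space)

sublocale S: product_prob_space "\<lambda>_. step_measure" "V \<times> UNIV"
  by (intro product_prob_spaceI prob_space_step_law)

lemma finite_V [simp]: "finite V"
  by (simp add: cycle_vertices_def)

text \<open>
  The two neighbours differ because \<open>n \<ge> 3\<close>; this is what makes every jump a fair sign.
\<close>

lemma neighbours: "x \<in> V \<Longrightarrow> E `` {x} = {(x + 1) mod n, (x + n - 1) mod n}"
  "x \<in> V \<Longrightarrow> (x + 1) mod n \<noteq> (x + n - 1) mod n"
proof -
  assume "x \<in> V"
  then have x: "x < n" by (simp add: cycle_vertices_def)
  have 1: "y = (x + n - 1) mod n \<longleftrightarrow> x = Suc y mod n" if "y < n" for y
  proof (cases "x = 0")
    case True
    then show ?thesis using that n_ge_3 by (auto simp: mod_Suc)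
  next
    case False
    then have "(x + n - 1) mod n = (x - 1)" using x by (simp add: mod_if)
    then show ?thesis using that x False by (auto simp: mod_Suc)
  qed
  have n0: "0 < n" using n_ge_3 by simp
  have "(x + n - 1) mod n < n" "(x + 1) mod n < n" using n0 by auto
  moreover have "y \<in> E `` {x} \<longleftrightarrow> y < n \<and> (y = (x + 1) mod n \<or> y = (x + n - 1) mod n)" for y
    using x 1[of y] by (auto simp: cycle_edges_def)
  ultimately show "E `` {x} = {(x + 1) mod n, (x + n - 1) mod n}"
    by (intro set_eqI) blast
  show "(x + 1) mod n \<noteq> (x + n - 1) mod n"
  proof
    assume "(x + 1) mod n = (x + n - 1) mod n"
    then have "x = Suc (Suc x mod n) mod n" using 1[of "(x + 1) mod n"] n0 by auto
    then show False using x n_ge_3 by (auto simp: mod_Suc split: if_splits)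
  qed
qed

lemma emeasure_step_law_Times:
  assumes "A \<in> sets borel"
  shows "emeasure step_measure (A \<times> B) = emeasure wait_measure A * emeasure (measure_pmf choice_pmf) B"
proof -
  show ?thesis unfolding step_law_def using assms
    by (subst measure_pmf.emeasure_pair_measure_Times) auto
qed

lemma prob_choice:
  assumes "x \<in> V" "y \<in> E `` {x}"
  shows "emeasure (measure_pmf choice_pmf) {f. f x = y} = ennreal (1 / 2)"
proof -
  have fin: "finite (E `` {x})" "E `` {x} \<noteq> {}" "card (E `` {x}) = 2"
    using neighbours[OF assms(1)] by auto
  have "emeasure (measure_pmf choice_pmf) {f. f x = y} = emeasure (measure_pmf (map_pmf (\<lambda>f. f x) choice_pmf)) {y}"
    by (simp add: vimage_def)
  also have "map_pmf (\<lambda>f. f x) choice_pmf = pmf_of_set (E `` {x})"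
    using assms by (subst Pi_pmf_component) auto
  also have "emeasure (measure_pmf \<dots>) {y} = ennreal (1 / 2)"
    using assms fin by (simp add: emeasure_pmf_single pmf_of_set)
  finally show ?thesis .
qed

lemma AE_choice: "AE f in measure_pmf choice_pmf. \<forall>x\<in>V. f x \<in> E `` {x}"
proof (rule AE_pmfI, safe)
  fix f x assume "f \<in> set_pmf choice_pmf" and x: "x \<in> V"
  then have "f \<in> PiE_dflt V undefined (set_pmf \<circ> (\<lambda>x. pmf_of_set (E `` {x})))"
    by (simp add: set_Pi_pmf)
  then have "f x \<in> set_pmf (pmf_of_set (E `` {x}))" using x by (auto simp: PiE_dflt_def)
  also have "\<dots> = E `` {x}" using neighbours[OF x] by (intro set_pmf_of_set) auto
  finally show "(x, f x) \<in> E" by simp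
qed

lemma emeasure_coordinates:
  assumes "finite J" "J \<subseteq> V \<times> UNIV" "\<And>i. i \<in> J \<Longrightarrow> A i \<in> sets borel"
  shows "emeasure M {\<omega>\<in>space M. \<forall>i\<in>J. fst (\<omega> i) \<in> A i \<and> snd (\<omega> i) \<in> B i} =
     (\<Prod>i\<in>J. emeasure wait_measure (A i) * emeasure (measure_pmf choice_pmf) (B i))"
proof -
  have "A i \<times> B i \<in> sets step_measure" if "i \<in> J" for i
    unfolding step_law_def using assms(3)[OF that] by (intro pair_measureI) auto
  from S.emeasure_PiM_Collect[OF assms(2,1) this]
  show ?thesis using assms unfolding walkers_space_def
    by (simp add: emeasure_step_law_Times mem_Times_iff)
qed

lemma indep_coordinates: "indep_vars (\<lambda>_. step_measure) (\<lambda>i \<omega>. \<omega> i) (V \<times> UNIV)"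
proof -
  have ne: "V \<times> (UNIV :: nat set) \<noteq> {}" using n_ge_3 by (auto simp: cycle_vertices_def lessThan_empty_iff)
  have rv: "(\<lambda>\<omega>. \<omega> i) \<in> M \<rightarrow>\<^sub>M step_measure" if "i \<in> V \<times> UNIV" for i
    unfolding walkers_space_def using that by measurable
  have "distr M (\<Pi>\<^sub>M i\<in>V \<times> UNIV. step_measure) (\<lambda>x. \<lambda>i\<in>V \<times> UNIV. x i) = distr M M (\<lambda>x. x)"
    unfolding walkers_space_def by (intro distr_cong) (auto simp: space_PiM PiE_def extensional_restrict)
  also have "\<dots> = M" by (rule distr_id)
  also have "M = (\<Pi>\<^sub>M i\<in>V \<times> UNIV. distr M step_measure (\<lambda>\<omega>. \<omega> i))"
    unfolding walkers_space_def
    by (intro PiM_cong refl distr_PiM_component[symmetric] prob_space_step_law) auto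
  finally show ?thesis by (subst indep_vars_iff_distr_eq_PiM'[OF ne rv]) auto
qed

text \<open>
  Independence for events of different walkers. Each \<open>P i\<close> is a property of the whole configuration
  that looks only at the walkers in \<open>F i\<close>, so events need not be transported to the product over \<open>F i\<close>.
\<close>

lemma prob_disjoint_walkers:
  assumes fin: "finite I" and sub: "\<And>i. i \<in> I \<Longrightarrow> F i \<subseteq> V" and disj: "disjoint_family_on F I"
    and meas: "\<And>i. i \<in> I \<Longrightarrow> Measurable.pred (walkers_space (F i) E) (P i)"
    and local: "\<And>i \<omega> \<omega>'. i \<in> I \<Longrightarrow> (\<And>v k. v \<in> F i \<Longrightarrow> \<omega> (v, k) = \<omega>' (v, k)) \<Longrightarrow> P i \<omega> = P i \<omega>'"
  shows "\<P>(\<omega> in M. \<forall>i\<in>I. P i \<omega>) = (\<Prod>i\<in>I. \<P>(\<omega> in M. P i \<omega>))"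
proof -
  let ?K = "\<lambda>i. F i \<times> (UNIV :: nat set)"
  let ?N = "\<lambda>i. PiM (?K i) (\<lambda>_. step_measure)"
  let ?X = "\<lambda>i \<omega>. restrict (\<lambda>j. \<omega> j) (?K i)"
  have "disjoint_family_on ?K I"
    using disj unfolding disjoint_family_on_def by blast
  then have ind: "indep_vars ?N ?X I"
    using sub by (intro indep_vars_restrict[OF indep_coordinates]) auto
  have sets: "sets (?N i) = sets (walkers_space (F i) E)" for i
    unfolding walkers_space_def by (intro sets_PiM_cong refl) (simp add: sets_step_law)
  then have sp: "space (?N i) = space (walkers_space (F i) E)" for i by (rule sets_eq_imp_space_eq)
  have PX: "P i (?X i \<omega>) = P i \<omega>" if "i \<in> I" for i \<omega>
    using that by (intro local) auto
  have m: "{x \<in> space (?N i). P i x} \<in> sets (?N i)" if "i \<in> I" for i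
    using meas[OF that] by (simp add: sets sp pred_def)
  have ev: "indep_events (\<lambda>i. {\<omega>\<in>space M. P i (?X i \<omega>)}) I"
    by (intro indep_eventsI_indep_vars[OF ind] m)
  show "\<P>(\<omega> in M. \<forall>i\<in>I. P i \<omega>) = (\<Prod>i\<in>I. \<P>(\<omega> in M. P i \<omega>))"
  proof (cases "I = {}")
    case False
    have "prob (\<Inter>i\<in>I. {\<omega>\<in>space M. P i (?X i \<omega>)}) = (\<Prod>i\<in>I. prob {\<omega>\<in>space M. P i (?X i \<omega>)})"
      using ev fin False unfolding indep_events_def by auto
    also have "(\<Inter>i\<in>I. {\<omega>\<in>space M. P i (?X i \<omega>)}) = {\<omega>\<in>space M. \<forall>i\<in>I. P i \<omega>}"
      using False PX by auto
    also have "(\<Prod>i\<in>I. prob {\<omega>\<in>space M. P i (?X i \<omega>)}) = (\<Prod>i\<in>I. \<P>(\<omega> in M. P i \<omega>))"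
      by (intro prod.cong refl) (simp add: PX)
    finally show ?thesis .
  qed (simp add: prob_space)
qed

section \<open>Jump times\<close>

lemma measurable_coordinate: "i \<in> V \<times> UNIV \<Longrightarrow> (\<lambda>\<omega>. \<omega> i) \<in> M \<rightarrow>\<^sub>M step_measure"
  unfolding walkers_space_def by measurable

lemma measurable_fst_step_measure: "fst \<in> step_measure \<rightarrow>\<^sub>M borel"
  using measurable_fst[of wait_measure "measure_pmf choice_pmf"] by (simp add: step_law_def)

lemma distributed_wait:
  assumes "i \<in> V \<times> UNIV"
  shows "distributed M lborel (\<lambda>\<omega>. fst (\<omega> i)) (exponential_density 1)"
proof -
  have "distr M lborel (\<lambda>\<omega>. fst (\<omega> i)) = distr (distr M step_measure (\<lambda>\<omega>. \<omega> i)) lborel fst"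
    using measurable_coordinate[OF assms] measurable_fst_step_measure by (subst distr_distr) (auto simp: comp_def)
  also have "distr M step_measure (\<lambda>\<omega>. \<omega> i) = step_measure"
    unfolding walkers_space_def using assms by (intro distr_PiM_component prob_space_step_law)
  also have "distr step_measure lborel fst = wait_measure"
  proof (rule measure_eqI)
    fix A assume "A \<in> sets (distr step_measure lborel fst)"
    then have A: "A \<in> sets borel" by simp
    have "emeasure (distr step_measure lborel fst) A = emeasure step_measure (A \<times> UNIV)"
      using A measurable_fst_step_measure
      by (subst emeasure_distr)
        (auto simp: step_law_def space_pair_measure intro!: arg_cong2[where f = emeasure])
    also have "\<dots> = emeasure wait_measure A"
      using A measure_pmf.emeasure_space_1[of choice_pmf] by (simp add: emeasure_step_law_Times)
    finally show "emeasure (distr step_measure lborel fst) A = emeasure wait_measure A" .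
  qed simp
  finally show ?thesis
    using measurable_compose[OF measurable_coordinate[OF assms] measurable_fst_step_measure]
    by (auto simp: distributed_def)
qed

lemma indep_waits: "indep_vars (\<lambda>_. borel) (\<lambda>i \<omega>. fst (\<omega> i)) (V \<times> UNIV)"
  using indep_vars_compose[OF indep_coordinates, of "\<lambda>_. fst" "\<lambda>_. borel"] measurable_fst_step_measure
  by (simp add: comp_def)

lemma jump_time_eq_sum: "jump_time \<omega> v k = (\<Sum>i\<in>{v} \<times> {..<k}. fst (\<omega> i))"
  by (simp add: jump_time_def sum.cartesian_product')

text \<open>
  A sum of independent exponential waiting times has an Erlang distribution, whose distribution function is a
  Poisson tail.
\<close>

lemma distributed_jump_time:
  assumes "v \<in> V"
  shows "distributed M lborel (\<lambda>\<omega>. jump_time \<omega> v (Suc k)) (erlang_density k 1)"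
proof -
  have "indep_vars (\<lambda>_. borel) (\<lambda>i \<omega>. fst (\<omega> i)) ({v} \<times> {..<Suc k})"
    using assms by (intro indep_vars_subset[OF indep_waits]) auto
  from exponential_distributed_sum[OF _ _ _ _ this, of 1]
  show ?thesis using distributed_wait assms
    by (auto simp: jump_time_eq_sum card_cartesian_product lessThan_empty_iff)
qed

lemma prob_jump_time_le:
  assumes v: "v \<in> V" and t: "0 \<le> t"
  shows "\<P>(\<omega> in M. jump_time \<omega> v k \<le> t) \<le> exp t / 2 ^ k"
proof (cases k)
  case 0
  have "\<P>(\<omega> in M. jump_time \<omega> v k \<le> t) \<le> 1" by (rule prob_le_1)
  also have "\<dots> \<le> exp t" using t by simp
  finally show ?thesis using 0 by simp
next
  case (Suc k')
  have "\<P>(\<omega> in M. jump_time \<omega> v k \<le> t) = erlang_CDF k' 1 t"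
    unfolding Suc by (rule erlang_distributed_le[OF distributed_jump_time[OF v]]) (use t in auto)
  also have "\<dots> = 1 - (\<Sum>n<k. t ^ n * exp (- t) / fact n)"
    using t by (simp add: erlang_CDF_def Suc lessThan_Suc_atMost)
  also have "\<dots> \<le> exp t / 2 ^ k" by (rule poisson_upper_tail[OF t])
  finally show ?thesis .
qed

lemma prob_jump_time_gt:
  assumes v: "v \<in> V" and t: "0 \<le> t"
  shows "\<P>(\<omega> in M. t < jump_time \<omega> v m) \<le> 2 ^ m * exp (- t / 2)"
proof (cases m)
  case 0
  then show ?thesis using t by (simp add: jump_time_def)
next
  case (Suc k)
  have "\<P>(\<omega> in M. t < jump_time \<omega> v m) = 1 - erlang_CDF k 1 t"
    unfolding Suc by (rule erlang_distributed_gt[OF distributed_jump_time[OF v]]) (use t in auto)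
  also have "\<dots> = (\<Sum>n<m. t ^ n * exp (- t) / fact n)"
    using t by (simp add: erlang_CDF_def Suc lessThan_Suc_atMost)
  also have "\<dots> \<le> 2 ^ m * exp (- t / 2)" by (rule poisson_lower_tail[OF t])
  finally show ?thesis .
qed

lemma prob_first_jump_gt:
  assumes "v \<in> V" "0 \<le> t"
  shows "\<P>(\<omega> in M. t < jump_time \<omega> v 1) = exp (- t)"
  using erlang_distributed_gt[OF distributed_jump_time[OF assms(1), of 0], of t] assms(2)
  by (simp add: erlang_CDF_def)

lemma AE_waits_pos: "AE \<omega> in M. \<forall>v\<in>V. \<forall>k. 0 < fst (\<omega> (v, k))"
proof -
  have "AE \<omega> in M. 0 < fst (\<omega> (v, k))" if "v \<in> V" for v k
  proof -
    have "prob {\<omega>\<in>space M. 0 < fst (\<omega> (v, k))} = 1"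
      using exponential_distributedD_gt[OF distributed_wait[of "(v, k)"], of 0] that by simp
    then show ?thesis using prob_Collect_eq_1 measurable_step(1)[OF that, of k E] by simp
  qed
  then show ?thesis by (simp add: AE_all_countable AE_ball_countable countable_finite)
qed

lemma AE_jump_times_unbounded: "AE \<omega> in M. \<forall>v\<in>V. \<exists>k. t < jump_time \<omega> v (Suc k)"
proof -
  have "AE \<omega> in M. \<exists>k. t < jump_time \<omega> v (Suc k)" if v: "v \<in> V" for v
  proof -
    note [measurable] = measurable_jump_time[OF v]
    define B where "B = {\<omega>\<in>space M. \<not> (\<exists>k. t < jump_time \<omega> v (Suc k))}"
    have B: "B \<in> events" unfolding B_def by measurable
    have "prob B \<le> exp \<bar>t\<bar> / 2 ^ Suc k" for k
    proof -
      have "prob B \<le> \<P>(\<omega> in M. jump_time \<omega> v (Suc k) \<le> \<bar>t\<bar>)"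
        unfolding B_def by (intro finite_measure_mono) (auto simp: not_less intro: order_trans[OF _ abs_ge_self])
      also have "\<dots> \<le> exp \<bar>t\<bar> / 2 ^ Suc k" using v by (intro prob_jump_time_le) auto
      finally show ?thesis .
    qed
    moreover have "(\<lambda>k. exp \<bar>t\<bar> / 2 ^ Suc k) \<longlonglongrightarrow> 0"
      by (rule LIMSEQ_Suc[OF LIMSEQ_divide_realpow_zero]) simp
    ultimately have "prob B \<le> 0" by (intro LIMSEQ_le_const) auto
    then have "prob B = 0" using measure_nonneg[of M B] by linarith
    then have "B \<in> null_sets M" using B by (simp add: emeasure_eq_measure null_sets_def)
    then show ?thesis unfolding B_def by (intro AE_I') auto
  qed
  then show ?thesis by (simp add: AE_ball_countable countable_finite)
qed

text \<open>
  For any fixed value of the second time, the first one avoids it almost surely, as it has a density and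
  is independent of the second. The index \<open>Suc i\<close> excludes the common value \<open>0\<close> of all zeroth jump times.
\<close>

lemma AE_jump_times_distinct:
  "AE \<omega> in M. \<forall>u\<in>V. \<forall>v\<in>V. u \<noteq> v \<longrightarrow> (\<forall>i j. jump_time \<omega> u (Suc i) \<noteq> jump_time \<omega> v j)"
proof -
  have "AE \<omega> in M. jump_time \<omega> u (Suc i) \<noteq> jump_time \<omega> v j"
    if u: "u \<in> V" and v: "v \<in> V" and uv: "u \<noteq> v" for u v i j
  proof -
    let ?A = "{u} \<times> {..<Suc i}" and ?B = "{v} \<times> {..<j}"
    let ?X = "\<lambda>\<omega>. jump_time \<omega> u (Suc i)" and ?Y = "\<lambda>\<omega>. jump_time \<omega> v j"
    let ?f = "\<lambda>C x. \<Sum>c\<in>C. x c :: real"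
    have "indep_var (PiM ?B (\<lambda>_. borel)) (\<lambda>\<omega>. restrict (\<lambda>c. fst (\<omega> c)) ?B)
        (PiM ?A (\<lambda>_. borel)) (\<lambda>\<omega>. restrict (\<lambda>c. fst (\<omega> c)) ?A)"
      using u v uv by (intro indep_var_restrict[OF indep_waits]) auto
    from indep_var_compose[OF this, of "?f ?B" borel "?f ?A" borel]
    have ind: "indep_var borel ?Y borel ?X"
      by (simp add: comp_def jump_time_eq_sum)
    have rv: "?X \<in> borel_measurable M" "?Y \<in> borel_measurable M"
      using u v by (auto intro: measurable_jump_time)
    interpret X: prob_space "distr M borel ?X" using rv by (intro prob_space_distr) auto
    interpret Y: prob_space "distr M borel ?Y" using rv by (intro prob_space_distr) auto
    interpret YX: pair_sigma_finite "distr M borel ?Y" "distr M borel ?X" ..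
    have "distr M lborel ?X = density lborel (erlang_density i 1)"
      by (rule distributed_distr_eq_density[OF distributed_jump_time[OF u]])
    moreover have "distr M borel ?X = distr M lborel ?X" by (rule distr_cong) auto
    ultimately have dens: "distr M borel ?X = density lborel (erlang_density i 1)" by simp
    have null: "AE x in distr M borel ?X. x \<noteq> y" for y
      unfolding dens by (subst AE_density) (auto intro!: AE_I'[of "{y}"] simp: null_sets_def)
    have meas: "{z \<in> space (borel \<Otimes>\<^sub>M borel). snd z \<noteq> (fst z :: real)} \<in> sets (borel \<Otimes>\<^sub>M borel)"
      by measurable
    have sets: "sets (distr M borel ?Y \<Otimes>\<^sub>M distr M borel ?X) = sets (borel \<Otimes>\<^sub>M borel)"
      by (intro sets_pair_measure_cong) auto
    have "AE z in distr M borel ?Y \<Otimes>\<^sub>M distr M borel ?X. snd z \<noteq> fst z"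
      using null by (subst YX.AE_pair_iff[symmetric]) (use meas in \<open>auto simp: sets sets_eq_imp_space_eq[OF sets]\<close>)
    then have "AE z in distr M (borel \<Otimes>\<^sub>M borel) (\<lambda>\<omega>. (?Y \<omega>, ?X \<omega>)). snd z \<noteq> fst z"
      using ind unfolding indep_var_distribution_eq by (metis (no_types, lifting))
    from AE_distrD[OF _ this] rv show ?thesis by simp
  qed
  then show ?thesis by (simp add: AE_all_countable AE_ball_countable countable_finite)
qed

section \<open>The directions of the jumps\<close>

text \<open>
  The projection of the integer line, the universal cover, onto the cycle.
\<close>

definition vertex :: "int \<Rightarrow> nat" where
  "vertex z = nat (z mod int n)"

lemma int_vertex: "int (vertex z) = z mod int n"
  using n_ge_3 by (simp add: vertex_def)

lemma vertex_in_V [simp]: "vertex z \<in> V"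
  using n_ge_3 pos_mod_bound[of "int n" z] unfolding cycle_vertices_def vertex_def by (simp add: nat_less_iff)

lemma vertex_of_nat [simp]: "v \<in> V \<Longrightarrow> vertex (int v) = v"
  by (simp add: vertex_def cycle_vertices_def)

lemma vertex_eq_iff: "vertex y = vertex z \<longleftrightarrow> int n dvd y - z"
  by (metis int_vertex mod_eq_dvd_iff vertex_def)

lemma vertex_succ: "(vertex z + 1) mod n = vertex (z + 1)"
proof -
  have "int ((vertex z + 1) mod n) = int (vertex (z + 1))"
    by (simp add: zmod_int int_vertex mod_simps add.commute)
  then show ?thesis by simp
qed

lemma vertex_pred: "(vertex z + n - 1) mod n = vertex (z - 1)"
proof -
  have "int ((vertex z + n - 1) mod n) = (int (vertex z) + int n - 1) mod int n"
    using n_ge_3 by (simp add: zmod_int of_nat_diff)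
  also have "\<dots> = int (vertex (z - 1))"
    by (metis (no_types, opaque_lifting) add.commute add_diff_eq int_vertex mod_add_self1 mod_diff_left_eq)
  finally show ?thesis by simp
qed

lemma neighbours_vertex: "E `` {vertex z} = {vertex (z + 1), vertex (z - 1)}"
  unfolding neighbours(1)[OF vertex_in_V] vertex_pred vertex_succ ..

lemma vertex_succ_neq_pred: "vertex (z + 1) \<noteq> vertex (z - 1)"
  using neighbours(2)[OF vertex_in_V, of z] unfolding vertex_pred vertex_succ .

definition went_up :: "(nat \<times> nat \<Rightarrow> real \<times> (nat \<Rightarrow> nat)) \<Rightarrow> nat \<Rightarrow> nat \<Rightarrow> bool" where
  "went_up \<omega> v j \<longleftrightarrow> jump_chain \<omega> v (Suc j) = (jump_chain \<omega> v j + 1) mod n"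

definition moves :: "(nat \<times> nat \<Rightarrow> real \<times> (nat \<Rightarrow> nat)) \<Rightarrow> nat \<Rightarrow> nat \<Rightarrow> bool list" where
  "moves \<omega> v m = map (went_up \<omega> v) [0..<m]"

lemma length_moves [simp]: "length (moves \<omega> v m) = m"
  by (simp add: moves_def)

lemma moves_0 [simp]: "moves \<omega> v 0 = []"
  by (simp add: moves_def)

lemma moves_Suc: "moves \<omega> v (Suc m) = moves \<omega> v m @ [went_up \<omega> v m]"
  by (simp add: moves_def)

lemma take_moves: "j \<le> m \<Longrightarrow> take j (moves \<omega> v m) = moves \<omega> v j"
  by (simp add: moves_def take_map)

definition displacement :: "(nat \<times> nat \<Rightarrow> real \<times> (nat \<Rightarrow> nat)) \<Rightarrow> nat \<Rightarrow> nat \<Rightarrow> int" where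
  "displacement \<omega> v m = endpoint (moves \<omega> v m)"

lemma displacement_0 [simp]: "displacement \<omega> v 0 = 0"
  by (simp add: displacement_def)

lemma displacement_Suc: "displacement \<omega> v (Suc m) = displacement \<omega> v m + step (went_up \<omega> v m)"
  by (simp add: displacement_def moves_Suc)

text \<open>
  This holds outside of a null set, and it makes each jump a step of \<open>\<plusminus>1\<close> on the cover.
\<close>

definition choices_ok :: "(nat \<times> nat \<Rightarrow> real \<times> (nat \<Rightarrow> nat)) \<Rightarrow> bool" where
  "choices_ok \<omega> \<longleftrightarrow> (\<forall>v\<in>V. \<forall>k. \<forall>x\<in>V. snd (\<omega> (v, k)) x \<in> E `` {x})"

lemma AE_choices_ok: "AE \<omega> in M. choices_ok \<omega>"
proof -
  have "AE \<omega> in M. \<forall>x\<in>V. snd (\<omega> (v, k)) x \<in> E `` {x}" if v: "v \<in> V" for v k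
  proof -
    have "AE z in step_measure. \<forall>x\<in>V. snd z x \<in> E `` {x}"
    proof -
      interpret W: prob_space wait_measure by (rule prob_space_exponential_density) simp
      interpret P: pair_sigma_finite wait_measure "measure_pmf choice_pmf" ..
      show ?thesis unfolding step_law_def
      proof (rule P.AE_pair_measure)
        have "{f. \<forall>x\<in>V. f x \<in> E `` {x}} \<in> sets (measure_pmf choice_pmf)" by simp
        from measurable_sets[OF measurable_snd this]
        have "snd -` {f. \<forall>x\<in>V. f x \<in> E `` {x}} \<inter> space (wait_measure \<Otimes>\<^sub>M measure_pmf choice_pmf)
            \<in> sets (wait_measure \<Otimes>\<^sub>M measure_pmf choice_pmf)" .
        also have "snd -` {f. \<forall>x\<in>V. f x \<in> E `` {x}} \<inter> space (wait_measure \<Otimes>\<^sub>M measure_pmf choice_pmf) =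
            {z \<in> space (wait_measure \<Otimes>\<^sub>M measure_pmf choice_pmf). \<forall>x\<in>V. snd z x \<in> E `` {x}}" by blast
        finally show "\<dots> \<in> sets (wait_measure \<Otimes>\<^sub>M measure_pmf choice_pmf)" .
        show "AE s in wait_measure. AE f in measure_pmf choice_pmf. \<forall>x\<in>V. snd (s, f) x \<in> E `` {x}"
          using AE_choice by simp
      qed
    qed
    then show ?thesis unfolding walkers_space_def
      using v by (intro AE_PiM_component[where P = "\<lambda>z. \<forall>x\<in>V. snd z x \<in> E `` {x}"] prob_space_step_law) auto
  qed
  then show ?thesis unfolding choices_ok_def by (simp add: AE_all_countable AE_ball_countable countable_finite)
qed

lemma jump_chain_eq_vertex:
  assumes "choices_ok \<omega>" "v \<in> V"
  shows "jump_chain \<omega> v m = vertex (int v + displacement \<omega> v m)"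
proof (induction m)
  case (Suc m)
  let ?z = "int v + displacement \<omega> v m"
  have "jump_chain \<omega> v (Suc m) \<in> E `` {vertex ?z}"
    using assms Suc unfolding choices_ok_def by (metis jump_chain.simps(2) vertex_in_V)
  then have "jump_chain \<omega> v (Suc m) = vertex (?z + 1) \<or> jump_chain \<omega> v (Suc m) = vertex (?z - 1)"
    by (simp add: neighbours_vertex)
  then show ?case
    using vertex_succ_neq_pred[of ?z] Suc
    by (auto simp: displacement_Suc went_up_def step_def vertex_succ[unfolded Suc_eq_plus1[symmetric]] algebra_simps simp del: jump_chain.simps)
qed (use assms in simp)

text \<open>
  Prescribing the signs prescribes the trajectory, hence amounts to one condition per step on a choice
  at a deterministic vertex. Such conditions concern different coordinates, so they are independent.
\<close>

lemma moves_eq_iff: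
  assumes "choices_ok \<omega>" "v \<in> V" "length s = m"
  shows "moves \<omega> v m = s \<longleftrightarrow>
    (\<forall>j<m. snd (\<omega> (v, j)) (vertex (int v + endpoint (take j s))) = vertex (int v + endpoint (take (Suc j) s)))"
  (is "_ \<longleftrightarrow> (\<forall>j<m. ?f j (?x j) = ?x (Suc j))")
proof
  assume s: "moves \<omega> v m = s"
  have "jump_chain \<omega> v j = ?x j" if "j \<le> m" for j
    using jump_chain_eq_vertex[OF assms(1,2), of j] take_moves[OF that, of \<omega> v] s
    by (simp add: displacement_def)
  then show "\<forall>j<m. ?f j (?x j) = ?x (Suc j)"
    by (metis Suc_leI jump_chain.simps(2) less_imp_le)
next
  assume *: "\<forall>j<m. ?f j (?x j) = ?x (Suc j)"
  have chain: "jump_chain \<omega> v j = ?x j" if "j \<le> m" for j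
    using that by (induction j) (use * assms in auto)
  show "moves \<omega> v m = s"
  proof (rule nth_equalityI)
    fix j assume "j < length (moves \<omega> v m)"
    then have j: "j < m" by simp
    have "?x (Suc j) = vertex (int v + endpoint (take j s) + step (s ! j))"
      using j assms(3) by (simp add: take_Suc_conv_app_nth algebra_simps)
    moreover have "went_up \<omega> v j \<longleftrightarrow> ?x (Suc j) = vertex (int v + endpoint (take j s) + 1)"
      using chain[of j] chain[of "Suc j"] j vertex_succ[of "int v + endpoint (take j s)"]
      by (simp add: went_up_def del: jump_chain.simps)
    ultimately have "went_up \<omega> v j \<longleftrightarrow> s ! j"
      using vertex_succ_neq_pred[of "int v + endpoint (take j s)"] by (cases "s ! j") (auto simp: step_def)
    then show "moves \<omega> v m ! j = s ! j" using j by (simp add: moves_def)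
  qed (use assms in simp)
qed

section \<open>Waiting times are independent of directions\<close>

abbreviation waits :: "nat \<Rightarrow> nat \<Rightarrow> (nat \<times> nat \<Rightarrow> real \<times> (nat \<Rightarrow> nat)) \<Rightarrow> nat \<Rightarrow> real" where
  "waits v K \<omega> \<equiv> \<lambda>i\<in>{..<K}. fst (\<omega> (v, i))"

lemma measurable_waits: "v \<in> V \<Longrightarrow> waits v K \<in> M \<rightarrow>\<^sub>M PiM {..<K} (\<lambda>_. borel)"
  by (intro measurable_restrict measurable_step) auto

lemma measurable_moves:
  assumes "v \<in> A"
  shows "(\<lambda>\<omega>. moves \<omega> v m) \<in> walkers_space A E \<rightarrow>\<^sub>M count_space UNIV"
proof (induction m)
  case (Suc m)
  have "Measurable.pred (walkers_space A E) (\<lambda>\<omega>. went_up \<omega> v m)"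
  proof -
    note [measurable] = measurable_jump_chain[OF assms, of m E] measurable_jump_chain[OF assms, of "Suc m" E]
    show ?thesis unfolding went_up_def by measurable
  qed
  then have "(\<lambda>\<omega>. s @ [went_up \<omega> v m]) \<in> walkers_space A E \<rightarrow>\<^sub>M count_space UNIV" for s
    by (rule measurable_compose) simp
  from measurable_compose_countable[OF this Suc] show ?case unfolding moves_Suc .
qed simp

text \<open>
  Conditioning on a prescribed trajectory does not change the law of the waiting times. Both sides are
  finite measures in \<open>Q\<close>, so it is enough to compare them on boxes, where they factor over the steps and each
  prescribed choice contributes \<open>1 / 2\<close>.
\<close>

lemma emeasure_waits_choices:
  assumes v: "v \<in> V" and m: "m \<le> K" and x: "\<And>j. j < m \<Longrightarrow> x j \<in> V \<and> x (Suc j) \<in> E `` {x j}"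
    and Q: "Q \<in> sets (PiM {..<K} (\<lambda>_. borel))"
  shows "emeasure M {\<omega>\<in>space M. waits v K \<omega> \<in> Q \<and> (\<forall>j<m. snd (\<omega> (v, j)) (x j) = x (Suc j))} =
    ennreal ((1 / 2) ^ m) * emeasure M {\<omega>\<in>space M. waits v K \<omega> \<in> Q}"
proof -
  let ?N = "PiM {..<K} (\<lambda>_. borel) :: (nat \<Rightarrow> real) measure"
  note w = measurable_waits[OF v, of K]
  define C where "C = {\<omega>\<in>space M. \<forall>j<m. snd (\<omega> (v, j)) (x j) = x (Suc j)}"
  have C: "C \<in> events"
  proof -
    have "Measurable.pred M (\<lambda>\<omega>. snd (\<omega> (v, j)) (x j) = x (Suc j))" for j
      by (rule measurable_compose[OF measurable_step(2)[OF v]]) simp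
    then show ?thesis unfolding C_def by measurable
  qed
  define P1 where "P1 = distr (density M (indicator C)) ?N (waits v K)"
  define P2 where "P2 = density (distr M ?N (waits v K)) (\<lambda>_. ennreal ((1 / 2) ^ m))"
  have P1: "emeasure P1 A = emeasure M {\<omega>\<in>space M. waits v K \<omega> \<in> A \<and> \<omega> \<in> C}" if A: "A \<in> sets ?N" for A
  proof -
    have "waits v K -` A \<inter> space M \<in> events" using w A by (rule measurable_sets)
    then have "emeasure P1 A = emeasure M (C \<inter> (waits v K -` A \<inter> space M))"
      unfolding P1_def using A C w
      by (subst emeasure_distr) (auto simp: emeasure_density indicator_inter_arith[symmetric])
    also have "C \<inter> (waits v K -` A \<inter> space M) = {\<omega>\<in>space M. waits v K \<omega> \<in> A \<and> \<omega> \<in> C}" by auto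
    finally show ?thesis .
  qed
  have P2: "emeasure P2 A = ennreal ((1 / 2) ^ m) * emeasure M {\<omega>\<in>space M. waits v K \<omega> \<in> A}" if A: "A \<in> sets ?N" for A
  proof -
    have "emeasure P2 A = ennreal ((1 / 2) ^ m) * emeasure (distr M ?N (waits v K)) A"
      unfolding P2_def using A by (subst emeasure_density) (auto simp: nn_integral_cmult_indicator)
    also have "emeasure (distr M ?N (waits v K)) A = emeasure M (waits v K -` A \<inter> space M)"
      using w A by (rule emeasure_distr)
    also have "waits v K -` A \<inter> space M = {\<omega>\<in>space M. waits v K \<omega> \<in> A}" by auto
    finally show ?thesis .
  qed
  have "P1 = P2"
  proof (rule measure_eqI_PiM_finite[where A = "\<lambda>_. space ?N"])
    fix A :: "nat \<Rightarrow> real set" assume A: "\<And>i. i \<in> {..<K} \<Longrightarrow> A i \<in> sets borel"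
    have box: "Pi\<^sub>E {..<K} A \<in> sets ?N" using A by (intro sets_PiM_I_finite) auto
    let ?J = "Pair v ` {..<K}"
    let ?B = "\<lambda>i. if snd i < m then {f. f (x (snd i)) = x (Suc (snd i))} else UNIV"
    have coord: "emeasure M {\<omega>\<in>space M. \<forall>i\<in>?J. fst (\<omega> i) \<in> A (snd i) \<and> snd (\<omega> i) \<in> B i} =
        (\<Prod>j<K. emeasure wait_measure (A j)) * (\<Prod>j<K. emeasure (measure_pmf choice_pmf) (B (v, j)))" for B
      using A v by (subst emeasure_coordinates) (auto simp: prod.reindex inj_on_def prod.distrib)
    have "emeasure P1 (Pi\<^sub>E {..<K} A) = emeasure M {\<omega>\<in>space M. \<forall>i\<in>?J. fst (\<omega> i) \<in> A (snd i) \<and> snd (\<omega> i) \<in> ?B i}"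
      unfolding P1[OF box] using m
      by (intro arg_cong[where f = "emeasure M"] Collect_cong conj_cong refl)
         (auto simp: C_def restrict_PiE_iff Pi_iff split: if_splits)
    also have "\<dots> = (\<Prod>j<K. emeasure wait_measure (A j)) * (\<Prod>j<K. emeasure (measure_pmf choice_pmf) (?B (v, j)))"
      by (rule coord)
    also have "(\<Prod>j<K. emeasure (measure_pmf choice_pmf) (?B (v, j))) = (\<Prod>j<K. if j < m then ennreal (1 / 2) else 1)"
      using x measure_pmf.emeasure_space_1[of choice_pmf]
      by (intro prod.cong refl) (auto simp: prob_choice simp del: ennreal_half)
    also have "\<dots> = ennreal (1 / 2) ^ m"
      using m by (subst prod.If_cases) (auto simp: Int_def conj_commute min_absorb1 simp del: ennreal_half
        intro!: arg_cong2[where f = "(^)"] arg_cong[where f = card, of _ "{..<m}", simplified])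
    also have "ennreal (1 / 2) ^ m = ennreal ((1 / 2) ^ m)" by (rule ennreal_power) simp
    also have "(\<Prod>j<K. emeasure wait_measure (A j)) = emeasure M {\<omega>\<in>space M. waits v K \<omega> \<in> Pi\<^sub>E {..<K} A}"
    proof -
      have "emeasure M {\<omega>\<in>space M. waits v K \<omega> \<in> Pi\<^sub>E {..<K} A} =
          emeasure M {\<omega>\<in>space M. \<forall>i\<in>?J. fst (\<omega> i) \<in> A (snd i) \<and> snd (\<omega> i) \<in> UNIV}"
        by (intro arg_cong[where f = "emeasure M"] Collect_cong conj_cong refl)
           (auto simp: restrict_PiE_iff Pi_iff)
      also have "\<dots> = (\<Prod>j<K. emeasure wait_measure (A j))"
        using coord[of "\<lambda>_. UNIV"] measure_pmf.emeasure_space_1[of choice_pmf] by simp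
      finally show ?thesis ..
    qed
    finally show "emeasure P1 (Pi\<^sub>E {..<K} A) = emeasure P2 (Pi\<^sub>E {..<K} A)"
      unfolding P2[OF box] by (simp add: mult.commute)
  next
    show "range (\<lambda>_::nat. space ?N) \<subseteq> prod_algebra {..<K} (\<lambda>_. borel)"
      by (auto simp: space_PiM intro!: prod_algebraI_finite)
    show "emeasure P1 (space ?N) \<noteq> \<infinity>"
      unfolding P1[OF sets.top] by (simp add: emeasure_eq_measure)
  qed (auto simp: P1_def P2_def)
  then show ?thesis using P1[OF Q] P2[OF Q] by (simp add: C_def conj_commute cong: conj_cong)
qed

lemma pred_moves [measurable]: "v \<in> V \<Longrightarrow> Measurable.pred M (\<lambda>\<omega>. R (moves \<omega> v m))"
  by (rule measurable_compose[OF measurable_moves]) auto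

text \<open>
  The sign list is uniform and independent of the waiting times: sum the probabilities of all
  trajectories that satisfy \<open>R\<close>.
\<close>

lemma prob_waits_moves:
  assumes v: "v \<in> V" and m: "m \<le> K" and Q: "Q \<in> sets (PiM {..<K} (\<lambda>_. borel))"
  shows "\<P>(\<omega> in M. waits v K \<omega> \<in> Q \<and> R (moves \<omega> v m)) = \<P>(\<omega> in M. waits v K \<omega> \<in> Q) * avg m (\<lambda>s. of_bool (R s))"
proof -
  have [measurable]: "Measurable.pred M (\<lambda>\<omega>. waits v K \<omega> \<in> Q)"
    by (rule measurable_compose[OF measurable_waits[OF v]]) (use Q in simp)
  define p where "p = \<P>(\<omega> in M. waits v K \<omega> \<in> Q)"
  let ?A = "\<lambda>s. {\<omega>\<in>space M. waits v K \<omega> \<in> Q \<and> moves \<omega> v m = s}"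
  have A: "?A s \<in> events" for s using v by measurable
  have single: "prob (?A s) = (1 / 2) ^ m * p" if s: "length s = m" for s
  proof -
    define x where "x j = vertex (int v + endpoint (take j s))" for j
    have x: "x j \<in> V \<and> x (Suc j) \<in> E `` {x j}" if "j < m" for j
      using that s unfolding x_def neighbours_vertex
      by (simp add: take_Suc_conv_app_nth step_def algebra_simps)
    let ?B = "{\<omega>\<in>space M. waits v K \<omega> \<in> Q \<and> (\<forall>j<m. snd (\<omega> (v, j)) (x j) = x (Suc j))}"
    have [measurable]: "Measurable.pred M (\<lambda>\<omega>. snd (\<omega> (v, j)) (x j) = x (Suc j))" for j
      by (rule measurable_compose[OF measurable_step(2)[OF v]]) simp
    have "prob (?A s) = prob ?B"
    proof (rule finite_measure_eq_AE)
      show "AE \<omega> in M. \<omega> \<in> ?A s \<longleftrightarrow> \<omega> \<in> ?B"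
        using AE_choices_ok by eventually_elim (simp add: moves_eq_iff[OF _ v s] x_def)
    qed (use A in measurable)
    also have "prob ?B = (1 / 2) ^ m * p"
    proof -
      have "ennreal (prob ?B) = ennreal ((1 / 2) ^ m) * ennreal p"
        using emeasure_waits_choices[OF v m, of x Q, OF x Q] unfolding emeasure_eq_measure p_def .
      also have "\<dots> = ennreal ((1 / 2) ^ m * p)"
        by (rule ennreal_mult[symmetric]) (auto simp: p_def)
      finally show ?thesis by (subst (asm) ennreal_inj) (auto simp: p_def)
    qed
    finally show ?thesis .
  qed
  have "{\<omega>\<in>space M. waits v K \<omega> \<in> Q \<and> R (moves \<omega> v m)} = (\<Union>s\<in>{s. length s = m \<and> R s}. ?A s)"
    by auto
  then have "\<P>(\<omega> in M. waits v K \<omega> \<in> Q \<and> R (moves \<omega> v m)) = prob (\<Union>s\<in>{s. length s = m \<and> R s}. ?A s)"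
    by (rule arg_cong)
  also have "\<dots> = (\<Sum>s | length s = m \<and> R s. prob (?A s))"
  proof (rule finite_measure_finite_Union)
    show "finite {s. length s = m \<and> R s}" by (rule finite_subset[OF _ finite_lists_length[of m]]) auto
    show "?A ` {s. length s = m \<and> R s} \<subseteq> events" using A by blast
    show "disjoint_family_on ?A {s. length s = m \<and> R s}" unfolding disjoint_family_on_def by blast
  qed
  also have "\<dots> = (\<Sum>s | length s = m \<and> R s. (1 / 2) ^ m * p)"
  proof (rule sum.cong[OF refl])
    fix s assume "s \<in> {s. length s = m \<and> R s}"
    then have "length s = m" by blast
    then show "prob (?A s) = (1 / 2) ^ m * p" by (rule single)
  qed
  also have "\<dots> = p * avg m (\<lambda>s. of_bool (R s))"
  proof -
    have "(\<Sum>s | length s = m. of_bool (R s)) = real (card {s. length s = m \<and> R s})"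
      using finite_lists_length[of m] by (simp add: sum_of_bool_eq Collect_conj_eq)
    then show ?thesis by (simp add: avg_def power_divide)
  qed
  finally show ?thesis by (simp add: p_def)
qed

text \<open>
  At most \<open>T\<close> jumps are made by time \<open>t\<close>, and \<open>T\<close> steps of the walk would not reach level \<open>k\<close>. Using a
  deterministic number of steps makes the two conditions independent; together they imply that the level is not
  reached by time \<open>t\<close>.
\<close>

definition stays :: "nat \<Rightarrow> real \<Rightarrow> bool \<Rightarrow> int \<Rightarrow> (nat \<times> nat \<Rightarrow> real \<times> (nat \<Rightarrow> nat)) \<Rightarrow> nat \<Rightarrow> bool" where
  "stays T t b k \<omega> v \<longleftrightarrow> t < jump_time \<omega> v (Suc T) \<and> stays_below k (orient b (moves \<omega> v T))"

lemma measurable_stays: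
  assumes "v \<in> A"
  shows "Measurable.pred (walkers_space A E) (\<lambda>\<omega>. stays T t b k \<omega> v)"
proof -
  note [measurable] = measurable_jump_time[OF assms]
  have [measurable]: "Measurable.pred (walkers_space A E) (\<lambda>\<omega>. R (moves \<omega> v m))" for R m
    by (rule measurable_compose[OF measurable_moves[OF assms]]) auto
  show ?thesis unfolding stays_def by measurable
qed

lemma jump_time_waits: "i \<le> K \<Longrightarrow> jump_time \<omega> v i = (\<Sum>j<i. waits v K \<omega> j)"
  unfolding jump_time_def by (intro sum.cong) auto

lemma prob_stays:
  assumes v: "v \<in> V" and t: "0 \<le> t"
  shows "\<P>(\<omega> in M. stays T t b k \<omega> v) \<ge> (1 - exp t / 2 ^ Suc T) * stay_prob T k"
proof -
  let ?N = "PiM {..<Suc T} (\<lambda>_. borel) :: (nat \<Rightarrow> real) measure"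
  let ?Q = "{x\<in>space ?N. t < (\<Sum>j<Suc T. x j)}"
  have Q: "?Q \<in> sets ?N" by measurable
  have wQ: "waits v (Suc T) \<omega> \<in> ?Q \<longleftrightarrow> t < jump_time \<omega> v (Suc T)" for \<omega>
    using jump_time_waits[of "Suc T" "Suc T" \<omega> v] by (simp add: space_PiM)
  note [measurable] = measurable_jump_time[OF v]
  have "\<P>(\<omega> in M. stays T t b k \<omega> v) =
      \<P>(\<omega> in M. waits v (Suc T) \<omega> \<in> ?Q \<and> stays_below k (orient b (moves \<omega> v T)))"
    unfolding stays_def wQ ..
  also have "\<dots> = \<P>(\<omega> in M. t < jump_time \<omega> v (Suc T)) * stay_prob T k"
    using prob_waits_moves[OF v _ Q, of T "\<lambda>s. stays_below k (orient b s)"]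
    unfolding wQ stay_prob_def avg_orient[of T "\<lambda>s. of_bool (stays_below k s)"] by simp
  also have "\<P>(\<omega> in M. t < jump_time \<omega> v (Suc T)) = 1 - \<P>(\<omega> in M. jump_time \<omega> v (Suc T) \<le> t)"
    by (subst prob_neg[symmetric]) (auto simp: not_le)
  finally show ?thesis
    using prob_jump_time_le[OF v t, of "Suc T"] stay_prob_nonneg[of T k] by (auto intro!: mult_right_mono)
qed

section \<open>The displacement at a fixed time\<close>

text \<open>
  Exactly \<open>m\<close> jumps were made by time \<open>t\<close>. All earlier jump times are mentioned so that \<open>m\<close> is unique for every
  configuration, including those in which some waiting time is negative.
\<close>

definition has_jumped :: "(nat \<times> nat \<Rightarrow> real \<times> (nat \<Rightarrow> nat)) \<Rightarrow> nat \<Rightarrow> real \<Rightarrow> nat \<Rightarrow> bool" where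
  "has_jumped \<omega> v t m \<longleftrightarrow> (\<forall>i\<le>m. jump_time \<omega> v i \<le> t) \<and> t < jump_time \<omega> v (Suc m)"

lemma has_jumped_unique: "has_jumped \<omega> v t m \<Longrightarrow> has_jumped \<omega> v t m' \<Longrightarrow> m = m'"
  unfolding has_jumped_def by (metis Suc_leI linorder_neqE_nat not_less)

lemma position_has_jumped:
  assumes "has_jumped \<omega> v t m"
  shows "position \<omega> v t = jump_chain \<omega> v m"
proof -
  have "(LEAST k. t < jump_time \<omega> v (Suc k)) = m"
    using assms unfolding has_jumped_def by (intro Least_equality) (auto, metis Suc_leI leD not_less)
  then show ?thesis by (simp add: position_def)
qed

lemma has_jumpedE:
  assumes "0 \<le> t" "t < jump_time \<omega> v (Suc k)"
  obtains m where "m \<le> k" "has_jumped \<omega> v t m"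
proof -
  define m where "m = (LEAST k. t < jump_time \<omega> v (Suc k))"
  have m: "t < jump_time \<omega> v (Suc m)" unfolding m_def by (rule LeastI) fact
  have "jump_time \<omega> v i \<le> t" if "i \<le> m" for i
  proof (cases i)
    case (Suc i')
    then show ?thesis using that not_less_Least[of i' "\<lambda>k. t < jump_time \<omega> v (Suc k)"] by (simp add: m_def)
  qed (use assms in \<open>simp add: jump_time_def\<close>)
  moreover have "m \<le> k" unfolding m_def by (rule Least_le) fact
  ultimately show ?thesis using that m by (auto simp: has_jumped_def)
qed

definition moved :: "real \<Rightarrow> bool \<Rightarrow> nat \<Rightarrow> (nat \<times> nat \<Rightarrow> real \<times> (nat \<Rightarrow> nat)) \<Rightarrow> nat \<Rightarrow> bool" where
  "moved t b d \<omega> v \<longleftrightarrow> (\<exists>m. has_jumped \<omega> v t m \<and> int d \<le> endpoint (orient b (moves \<omega> v m)))"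

lemma measurable_has_jumped:
  assumes "v \<in> A"
  shows "Measurable.pred (walkers_space A E) (\<lambda>\<omega>. has_jumped \<omega> v t m)"
proof -
  note [measurable] = measurable_jump_time[OF assms]
  show ?thesis unfolding has_jumped_def by measurable
qed

lemma measurable_moved:
  assumes "v \<in> A"
  shows "Measurable.pred (walkers_space A E) (\<lambda>\<omega>. moved t b d \<omega> v)"
proof -
  note [measurable] = measurable_has_jumped[OF assms]
  have [measurable]: "Measurable.pred (walkers_space A E) (\<lambda>\<omega>. R (moves \<omega> v m))" for R m
    by (rule measurable_compose[OF measurable_moves[OF assms]]) auto
  show ?thesis unfolding moved_def by measurable
qed

lemma prob_has_jumped_moves:
  assumes v: "v \<in> V"
  shows "\<P>(\<omega> in M. has_jumped \<omega> v t m \<and> R (moves \<omega> v m)) =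
     \<P>(\<omega> in M. has_jumped \<omega> v t m) * avg m (\<lambda>s. of_bool (R s))"
proof -
  let ?N = "PiM {..<Suc m} (\<lambda>_. borel) :: (nat \<Rightarrow> real) measure"
  let ?Q = "{x\<in>space ?N. (\<forall>i\<in>{..m}. (\<Sum>j\<in>{..<i} \<inter> {..<Suc m}. x j) \<le> t) \<and> t < (\<Sum>j<Suc m. x j)}"
  have Q: "?Q \<in> sets ?N" by measurable
  have "{..<i} \<inter> {..<Suc m} = {..<i}" if "i \<le> m" for i using that by auto
  then have wQ: "waits v (Suc m) \<omega> \<in> ?Q \<longleftrightarrow> has_jumped \<omega> v t m" for \<omega>
    using jump_time_waits[of _ "Suc m" \<omega> v] by (auto simp: space_PiM has_jumped_def)
  show ?thesis using prob_waits_moves[OF v _ Q, of m R] unfolding wQ by simp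
qed

text \<open>
  By the Poisson tails, the number of jumps lies between \<open>m0 = 8 d\<^sup>2\<close> and some large \<open>K\<close> with probability at
  least \<open>1 / 2\<close>. Given any such number, the walk has moved by \<open>d\<close> with probability at least \<open>1 / 16\<close>.
\<close>

lemma prob_moved:
  assumes v: "v \<in> V" and d: "1 \<le> d" and t: "32 * (real d)\<^sup>2 \<le> t"
  shows "\<P>(\<omega> in M. moved t b d \<omega> v) \<ge> 1 / 32"
proof -
  define m0 where "m0 = 8 * d\<^sup>2"
  have m0: "4 * real m0 \<le> t" using t by (simp add: m0_def)
  have "1 \<le> (real d)\<^sup>2" using d by simp
  then have t32: "32 \<le> t" using t by linarith
  obtain K0 where K0: "4 * exp t < 2 ^ K0" using real_arch_pow[of 2 "4 * exp t"] by auto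
  define K where "K = K0 + m0"
  have K: "4 * exp t \<le> 2 ^ Suc K"
  proof -
    have "(2 :: real) ^ K0 \<le> 2 ^ Suc K" unfolding K_def by (intro power_increasing) auto
    with K0 show ?thesis by linarith
  qed
  let ?J = "\<lambda>m. {\<omega>\<in>space M. has_jumped \<omega> v t m}"
  let ?S = "\<lambda>m. {\<omega>\<in>space M. has_jumped \<omega> v t m \<and> int d \<le> endpoint (orient b (moves \<omega> v m))}"
  note [measurable] = measurable_has_jumped[OF v] measurable_jump_time[OF v] measurable_moved[OF v]
  have S: "?S m \<in> events" for m using v by measurable
  have J: "?J m \<in> events" for m by measurable
  have disj: "disjoint_family_on ?J {m0..K}" "disjoint_family_on ?S {m0..K}"
    using has_jumped_unique unfolding disjoint_family_on_def by blast+
  have S_ge: "prob (?S m) \<ge> prob (?J m) / 16" if "m0 \<le> m" for m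
  proof -
    have "1 / 16 \<le> avg m (\<lambda>s. of_bool (int d \<le> endpoint s))"
      using that d by (intro srw_endpoint_ge) (auto simp: m0_def)
    also have "\<dots> = avg m (\<lambda>s. of_bool (int d \<le> endpoint (orient b s)))"
      by (rule avg_orient[symmetric])
    finally have "prob (?J m) * (1 / 16) \<le> prob (?J m) * avg m (\<lambda>s. of_bool (int d \<le> endpoint (orient b s)))"
      by (intro mult_left_mono) auto
    also have "\<dots> = prob (?S m)"
      using prob_has_jumped_moves[OF v, of t m "\<lambda>s. int d \<le> endpoint (orient b s)"] by simp
    finally show ?thesis by simp
  qed
  have "prob (\<Union>m\<in>{m0..K}. ?J m) = (\<Sum>m=m0..K. prob (?J m))"
    using J disj by (intro finite_measure_finite_Union) auto
  also have "\<dots> / 16 \<le> (\<Sum>m=m0..K. prob (?S m))"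
    unfolding sum_divide_distrib by (intro sum_mono S_ge) auto
  also have "(\<Sum>m=m0..K. prob (?S m)) = prob (\<Union>m\<in>{m0..K}. ?S m)"
    using S disj by (intro finite_measure_finite_Union[symmetric]) auto
  also have "\<dots> \<le> \<P>(\<omega> in M. moved t b d \<omega> v)"
  proof (rule finite_measure_mono)
    show "{\<omega>\<in>space M. moved t b d \<omega> v} \<in> events" by measurable
  qed (auto simp: moved_def)
  finally have main: "prob (\<Union>m\<in>{m0..K}. ?J m) / 16 \<le> \<P>(\<omega> in M. moved t b d \<omega> v)" by simp
  let ?early = "{\<omega>\<in>space M. jump_time \<omega> v (Suc K) \<le> t}" and ?late = "{\<omega>\<in>space M. t < jump_time \<omega> v m0}"
  have "1 = prob (space M)" by (simp add: prob_space)
  also have "\<dots> \<le> prob ((\<Union>m\<in>{m0..K}. ?J m) \<union> (?early \<union> ?late))"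
  proof (rule finite_measure_mono_AE)
    show "AE \<omega> in M. \<omega> \<in> space M \<longrightarrow> \<omega> \<in> (\<Union>m\<in>{m0..K}. ?J m) \<union> (?early \<union> ?late)"
      using AE_waits_pos
    proof eventually_elim
      case (elim \<omega>)
      have mono: "jump_time \<omega> v i \<le> jump_time \<omega> v j" if "i \<le> j" for i j
        unfolding jump_time_def using that elim v by (intro sum_mono2) (auto intro: less_imp_le)
      show ?case
      proof (intro impI, rule ccontr)
        assume \<omega>: "\<omega> \<in> space M" and no: "\<omega> \<notin> (\<Union>m\<in>{m0..K}. ?J m) \<union> (?early \<union> ?late)"
        then have K: "t < jump_time \<omega> v (Suc K)" and m0: "jump_time \<omega> v m0 \<le> t" by auto
        obtain m where m: "m \<le> K" "has_jumped \<omega> v t m"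
          using t32 by (auto intro: has_jumpedE[OF _ K])
        have "m0 \<le> m"
        proof (rule ccontr)
          assume "\<not> m0 \<le> m"
          then have "jump_time \<omega> v (Suc m) \<le> jump_time \<omega> v m0" by (intro mono) simp
          with m(2) m0 show False by (simp add: has_jumped_def)
        qed
        then show False using no m \<omega> by auto
      qed
    qed
  qed (use J in measurable)
  also have "\<dots> \<le> prob (\<Union>m\<in>{m0..K}. ?J m) + prob (?early \<union> ?late)"
    using J by (intro measure_Un_le) auto
  also have "prob (?early \<union> ?late) \<le> prob ?early + prob ?late"
    by (intro measure_Un_le) auto
  also have "prob ?early \<le> 1 / 4"
  proof -
    have "prob ?early \<le> exp t / 2 ^ Suc K" using v t32 by (intro prob_jump_time_le) auto
    also have "\<dots> \<le> 1 / 4" using K by (simp add: field_simps)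
    finally show ?thesis .
  qed
  also have "prob ?late \<le> 1 / 4"
  proof -
    have "prob ?late \<le> 2 ^ m0 * exp (- t / 2)" using v t32 by (intro prob_jump_time_gt) auto
    also have "(2 :: real) ^ m0 \<le> exp 1 ^ m0" using exp_ge_add_one_self[of 1] by (intro power_mono) auto
    also have "\<dots> = exp (real m0)" by (simp flip: exp_of_nat_mult)
    also have "\<dots> \<le> exp (t / 4)" using m0 by simp
    also have "exp (t / 4) * exp (- t / 2) = exp (- (t / 4))" by (simp flip: exp_add)
    also have "\<dots> \<le> exp (- 8)" using t32 by simp
    also have "\<dots> = inverse (exp 8)" by (rule exp_minus)
    also have "\<dots> \<le> inverse 4" using exp_ge_add_one_self[of 8] by (intro le_imp_inverse_le) auto
    finally show ?thesis by (simp add: mult_right_mono)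
  qed
  finally show ?thesis using main by linarith
qed

section \<open>Overtaking forces a meeting\<close>

lemma vertex_add_cong: "vertex (int (vertex z) + y) = vertex (z + y)"
  by (simp add: vertex_def[of "_ + _"] int_vertex mod_simps)

text \<open>
  The position on the cover, after \<open>m\<close> jumps, of the copy of a walker that starts at the integer \<open>u\<close>.
\<close>

definition lifted :: "(nat \<times> nat \<Rightarrow> real \<times> (nat \<Rightarrow> nat)) \<Rightarrow> int \<Rightarrow> nat \<Rightarrow> int" where
  "lifted \<omega> u m = u + displacement \<omega> (vertex u) m"

lemma lifted_0 [simp]: "lifted \<omega> u 0 = u"
  by (simp add: lifted_def)

lemma lifted_Suc: "\<bar>lifted \<omega> u (Suc m) - lifted \<omega> u m\<bar> = 1"
  by (simp add: lifted_def displacement_Suc step_def)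

lemma position_eq_vertex_lifted:
  assumes "choices_ok \<omega>" "has_jumped \<omega> (vertex u) t m"
  shows "position \<omega> (vertex u) t = vertex (lifted \<omega> u m)"
  using position_has_jumped[OF assms(2)] jump_chain_eq_vertex[OF assms(1) vertex_in_V]
  by (simp add: lifted_def vertex_add_cong)

text \<open>
  Under these conditions trajectories on the cover move by unit steps, and no two walkers jump at the same
  time.
\<close>

definition regular :: "(nat \<times> nat \<Rightarrow> real \<times> (nat \<Rightarrow> nat)) \<Rightarrow> bool" where
  "regular \<omega> \<longleftrightarrow> choices_ok \<omega> \<and> (\<forall>v\<in>V. \<forall>k. 0 < fst (\<omega> (v, k))) \<and>
     (\<forall>u\<in>V. \<forall>v\<in>V. u \<noteq> v \<longrightarrow> (\<forall>i j. jump_time \<omega> u (Suc i) \<noteq> jump_time \<omega> v j))"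

lemma AE_regular: "AE \<omega> in M. regular \<omega>"
  using AE_choices_ok AE_waits_pos AE_jump_times_distinct by eventually_elim (simp add: regular_def)

lemma jump_time_strict_mono:
  assumes "regular \<omega>" "v \<in> V"
  shows "strict_mono (jump_time \<omega> v)"
  unfolding strict_mono_Suc_iff using assms by (auto simp: jump_time_def regular_def)

lemma has_jumpedI:
  assumes "regular \<omega>" "v \<in> V" "jump_time \<omega> v m \<le> t" "t < jump_time \<omega> v (Suc m)"
  shows "has_jumped \<omega> v t m"
  using assms strict_mono_mono[OF jump_time_strict_mono[OF assms(1,2)]]
  by (auto simp: has_jumped_def mono_def intro: order_trans)

lemma met_by_mono: "met_by \<omega> s a b \<Longrightarrow> s \<le> t \<Longrightarrow> met_by \<omega> t a b"
  unfolding met_by_def by (meson order_trans)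

lemma met_by_sym: "met_by \<omega> s a b \<Longrightarrow> met_by \<omega> s b a"
  unfolding met_by_def by metis

text \<open>
  Induction on the total number of jumps. If the two lifted positions differ, undo the later one of the two last
  jumps: the order can change by at most one unit, so at that earlier time the left walker has still
  overtaken the right one.
\<close>

lemma overtaking_distinct_meet:
  assumes reg: "regular \<omega>" and uw: "u < w" and ne: "vertex u \<noteq> vertex w"
  shows "\<lbrakk>0 \<le> s; has_jumped \<omega> (vertex u) s i; has_jumped \<omega> (vertex w) s j;
      lifted \<omega> w j \<le> lifted \<omega> u i\<rbrakk> \<Longrightarrow> met_by \<omega> s (vertex u) (vertex w)"
proof (induction "i + j" arbitrary: i j s)
  case 0
  then show ?case using uw by simp
next
  case (Suc N)
  let ?a = "vertex u" and ?b = "vertex w"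
  let ?A = "jump_time \<omega> ?a" and ?B = "jump_time \<omega> ?b"
  note mono = strict_mono_less[OF jump_time_strict_mono[OF reg vertex_in_V]]
    strict_mono_less_eq[OF jump_time_strict_mono[OF reg vertex_in_V]]
  have z: "?A 0 = 0" "?B 0 = 0" by (simp_all add: jump_time_def)
  have ok: "choices_ok \<omega>" using reg by (simp add: regular_def)
  have dist: "?A (Suc i') \<noteq> ?B j'" "?B (Suc i') \<noteq> ?A j'" for i' j'
    using reg ne by (auto simp: regular_def)
  have jumped: "?A i \<le> s" "s < ?A (Suc i)" "?B j \<le> s" "s < ?B (Suc j)"
    using Suc.prems by (auto simp: has_jumped_def)
  show ?case
  proof (cases "lifted \<omega> w j = lifted \<omega> u i")
    case True
    then have "position \<omega> ?a s = position \<omega> ?b s"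
      using Suc.prems by (simp add: position_eq_vertex_lifted[OF ok])
    then show ?thesis using Suc.prems(1) unfolding met_by_def by blast
  next
    case False
    with Suc.prems(4) have less: "lifted \<omega> w j + 1 \<le> lifted \<omega> u i" by simp
    \<comment> \<open>whichever of the two walkers jumped last; no tie is possible\<close>
    consider i' where "i = Suc i'" "?B j < ?A i" | j' where "j = Suc j'" "?A i < ?B j"
    proof (cases i)
      case 0
      then obtain j' where "j = Suc j'" using Suc.hyps by (cases j) auto
      then show ?thesis using that(2) mono(1)[of w 0 j] z 0 by auto
    next
      case (Suc i')
      then have "?A i \<noteq> ?B j" using dist by simp
      then consider "?B j < ?A i" | "?A i < ?B j" by linarith
      then show ?thesis
      proof cases
        case 2
        then obtain j' where "j = Suc j'" using mono(2)[of u 0 i] z by (cases j) auto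
        then show ?thesis using that(2) 2 by blast
      qed (use that(1) Suc in blast)
    qed
    then show ?thesis
    proof cases
      case 1
      let ?s = "max (?A i') (?B j)"
      have "?A i' < ?A i" using 1 mono by simp
      then have "has_jumped \<omega> ?a ?s i'" "has_jumped \<omega> ?b ?s j"
        using 1 jumped by (auto intro!: has_jumpedI[OF reg])
      moreover have "0 \<le> ?s" using mono(2)[of w 0 j] z by simp
      moreover have "lifted \<omega> w j \<le> lifted \<omega> u i'"
        using less lifted_Suc[of \<omega> u i'] 1(1) by simp
      ultimately have "met_by \<omega> ?s ?a ?b" using Suc.hyps 1(1) by simp
      moreover have "?s \<le> s" using \<open>?A i' < ?A i\<close> jumped by simp
      ultimately show ?thesis by (rule met_by_mono)
    next
      case 2
      let ?s = "max (?A i) (?B j')"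
      have "?B j' < ?B j" using 2 mono by simp
      then have "has_jumped \<omega> ?a ?s i" "has_jumped \<omega> ?b ?s j'"
        using 2 jumped by (auto intro!: has_jumpedI[OF reg])
      moreover have "0 \<le> ?s" using mono(2)[of u 0 i] z by simp
      moreover have "lifted \<omega> w j' \<le> lifted \<omega> u i"
        using less lifted_Suc[of \<omega> w j'] 2(1) by simp
      ultimately have "met_by \<omega> ?s ?a ?b" using Suc.hyps 2(1) by simp
      moreover have "?s \<le> s" using \<open>?B j' < ?B j\<close> jumped by simp
      ultimately show ?thesis by (rule met_by_mono)
    qed
  qed
qed

lemma overtaking_meet:
  assumes reg: "regular \<omega>" and uw: "u < w" and s: "0 \<le> s"
    and i: "has_jumped \<omega> (vertex u) s i" and j: "has_jumped \<omega> (vertex w) s j"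
    and le: "lifted \<omega> w j \<le> lifted \<omega> u i"
  shows "met_by \<omega> s (vertex u) (vertex w)"
proof (cases "vertex u = vertex w")
  case True
  then have "i = j" using has_jumped_unique i j by metis
  then show ?thesis using le uw True by (simp add: lifted_def)
next
  case False
  show ?thesis by (rule overtaking_distinct_meet[OF reg uw False s i j le])
qed

section \<open>Connectivity from overtakings across every edge\<close>

definition met_rel :: "(nat \<times> nat \<Rightarrow> real \<times> (nat \<Rightarrow> nat)) \<Rightarrow> real \<Rightarrow> (nat \<times> nat) set" where
  "met_rel \<omega> t = {(x, y). x \<in> V \<and> y \<in> V \<and> met_by \<omega> t x y}"

lemma acquaintance_path_of_trancl:
  assumes "(a, b) \<in> (met_rel \<omega> t)\<^sup>+"
  shows "acquaintance_path V \<omega> t a b"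
  using assms
proof (induction rule: trancl_induct)
  case (base y)
  then show ?case unfolding acquaintance_path_def met_rel_def
    by (intro exI[of _ 0] exI[of _ "\<lambda>i. if i = 0 then a else y"]) auto
next
  case (step y z)
  then obtain k c where c: "c 0 = a" "c (Suc k) = y" "\<forall>i\<le>Suc k. c i \<in> V" "\<forall>i\<le>k. met_by \<omega> t (c i) (c (Suc i))"
    unfolding acquaintance_path_def by blast
  show ?case unfolding acquaintance_path_def
    using c step(2) unfolding met_rel_def
    by (intro exI[of _ "Suc k"] exI[of _ "\<lambda>i. if i \<le> Suc k then c i else z"]) (auto simp: le_Suc_eq)
qed

lemma sym_met_rel: "sym ((met_rel \<omega> t)\<^sup>+)"
  by (rule sym_trancl) (auto simp: sym_def met_rel_def intro: met_by_sym)

text \<open>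
  Let \<open>X z\<close> be the lifted position at time \<open>t\<close> of the walker from \<open>z\<close>. Then \<open>X w \<le> a < X u\<close> although \<open>u < w\<close>. For \<open>k\<close> between
  \<open>u\<close> and \<open>w\<close>, either \<open>X k \<le> X u\<close>, and \<open>k\<close> was overtaken by \<open>u\<close>, or \<open>X w \<le> X u < X k\<close>, and \<open>k\<close> overtook \<open>w\<close>. So \<open>u\<close> is connected
  to everything up to \<open>w\<close>. All this happens
  on the cover, where the stretch from \<open>u\<close> to \<open>w\<close> may be longer than the cycle.
\<close>

lemma acquainted_across_edge:
  assumes reg: "regular \<omega>" and t: "0 \<le> t" and unb: "\<And>v. v \<in> V \<Longrightarrow> \<exists>m. has_jumped \<omega> v t m"
    and ua: "u \<le> a" and aw: "a < w"
    and up: "moved t True d \<omega> (vertex u)" "a < u + int d"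
    and down: "moved t False e \<omega> (vertex w)" "w - int e \<le> a"
  shows "(vertex a, vertex (a + 1)) \<in> (met_rel \<omega> t)\<^sup>+"
proof -
  define X where "X z = lifted \<omega> z (SOME m. has_jumped \<omega> (vertex z) t m)" for z
  have some: "has_jumped \<omega> (vertex z) t (SOME m. has_jumped \<omega> (vertex z) t m)" for z
    by (rule someI_ex[OF unb[OF vertex_in_V]])
  have X: "X z = lifted \<omega> z m" if "has_jumped \<omega> (vertex z) t m" for z m
    unfolding X_def using has_jumped_unique[OF some that] by simp
  have meet: "(vertex y, vertex z) \<in> met_rel \<omega> t" if "y < z" "X z \<le> X y" for y z
    using overtaking_meet[OF reg that(1) t some some] that(2) by (auto simp: X_def met_rel_def)
  have "a < X u" using up X unfolding moved_def endpoint_orient by (auto simp: lifted_def displacement_def)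
  moreover have "X w \<le> a" using down X unfolding moved_def endpoint_orient by (auto simp: lifted_def displacement_def)
  ultimately have inv: "X w \<le> X u" by simp
  have refl: "(vertex y, vertex y) \<in> met_rel \<omega> t" for y
    using t by (auto simp: met_rel_def met_by_def)
  have between: "(vertex u, vertex k) \<in> (met_rel \<omega> t)\<^sup>+" if k: "u \<le> k" "k \<le> w" for k
  proof (cases "k = u")
    case False
    show ?thesis
    proof (cases "X k \<le> X u")
      case True
      then show ?thesis using meet[of u k] k False by auto
    next
      case False
      then have "(vertex k, vertex w) \<in> (met_rel \<omega> t)\<^sup>+"
        using meet[of k w] inv k refl by (cases "k = w") auto
      then have "(vertex w, vertex k) \<in> (met_rel \<omega> t)\<^sup>+" using sym_met_rel by (metis symD)
      moreover have "(vertex u, vertex w) \<in> (met_rel \<omega> t)\<^sup>+" using meet[of u w] inv ua aw by auto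
      ultimately show ?thesis by (rule trancl_trans[rotated])
    qed
  qed (use refl in auto)
  have "(vertex a, vertex u) \<in> (met_rel \<omega> t)\<^sup>+"
    using between[of a] ua aw sym_met_rel by (metis less_imp_le symD)
  moreover have "(vertex u, vertex (a + 1)) \<in> (met_rel \<omega> t)\<^sup>+"
    using between[of "a + 1"] ua aw by simp
  ultimately show ?thesis by (rule trancl_trans)
qed

lemma social_connectivity_time_le:
  assumes t: "0 \<le> t" and edges: "\<And>a. a < n \<Longrightarrow> (vertex (int a), vertex (int a + 1)) \<in> (met_rel \<omega> t)\<^sup>+"
  shows "social_connectivity_time V \<omega> \<le> ereal t"
proof -
  have from0: "(0, v) \<in> (met_rel \<omega> t)\<^sup>+" if "v \<in> V" for v
    using that
  proof (induction v)
    case 0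
    then have "(0, 0) \<in> met_rel \<omega> t" using t by (auto simp: met_rel_def met_by_def)
    then show ?case by blast
  next
    case (Suc v)
    then have v: "v \<in> V" by (simp add: cycle_vertices_def)
    then have "(v, Suc v) \<in> (met_rel \<omega> t)\<^sup>+"
      using edges[of v] vertex_of_nat[of v] vertex_of_nat[of "Suc v"] Suc.prems
      by (simp add: cycle_vertices_def add.commute)
    with Suc.IH[OF v] show ?case by (rule trancl_trans)
  qed
  have "acquaintance_path V \<omega> t a b" if "a \<in> V" "b \<in> V" for a b
    using from0[OF that(1)] from0[OF that(2)] sym_met_rel
    by (intro acquaintance_path_of_trancl) (metis symD trancl_trans)
  then show ?thesis unfolding social_connectivity_time_def using t by (intro Inf_lower) auto
qed

section \<open>Disconnection from two uncrossed cuts\<close>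

text \<open>
  The gap lies between \<open>c - 1\<close> and \<open>c\<close>. The walkers at distance \<open>k\<close> from it start at \<open>c - k\<close> on the left, where
  they must stay below displacement \<open>k\<close>, and at \<open>c + k - 1\<close> on the right, where this holds after reflection.
\<close>

definition good_cut :: "nat \<Rightarrow> nat \<Rightarrow> real \<Rightarrow> nat \<Rightarrow> (nat \<times> nat \<Rightarrow> real \<times> (nat \<Rightarrow> nat)) \<Rightarrow> bool" where
  "good_cut T r t c \<omega> \<longleftrightarrow>
     (\<forall>(k, b)\<in>{1..r} \<times> UNIV. stays T t b (int k) \<omega> (if b then c - k else c + k - 1))"

lemma stays_endpoint_less:
  assumes "stays T t b k \<omega> v" "0 \<le> s" "s \<le> t" "has_jumped \<omega> v s m"
  shows "endpoint (orient b (moves \<omega> v m)) < k"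
proof -
  have "s < jump_time \<omega> v (Suc T)" using assms by (simp add: stays_def)
  then have "m \<le> T" using has_jumpedE[OF assms(2)] has_jumped_unique[OF assms(4)] by metis
  then have "take m (orient b (moves \<omega> v T)) = orient b (moves \<omega> v m)"
    by (simp add: orient_def take_map take_moves)
  then show ?thesis using assms(1) \<open>m \<le> T\<close> unfolding stays_def stays_below_def
    by (metis (full_types) length_map length_moves orient_def)
qed

text \<open>
  Walkers within distance \<open>r\<close> are controlled by the cut, all others by their number of jumps.
\<close>

lemma good_cut_not_crossed:
  assumes cut: "good_cut T r t c \<omega>" "r \<le> c" and s: "0 \<le> s" "s \<le> t"
    and m: "has_jumped \<omega> v s m" "m \<le> r"
  shows "int v + displacement \<omega> v m < int c \<longleftrightarrow> v < c"
proof (cases "v < c")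
  case True
  have "displacement \<omega> v m < int c - int v"
  proof (cases "c - v \<le> r")
    case le: True
    then have "(c - v, True) \<in> {1..r} \<times> UNIV" using True by simp
    from bspec[OF cut(1)[unfolded good_cut_def] this] True
    have "stays T t True (int (c - v)) \<omega> v" by simp
    from stays_endpoint_less[OF this s m(1)] show ?thesis
      using True by (simp add: endpoint_orient displacement_def)
  next
    case False
    then show ?thesis using abs_endpoint_le[of "moves \<omega> v m"] m(2) by (simp add: displacement_def)
  qed
  then show ?thesis using True by simp
next
  case False
  have "- displacement \<omega> v m < int v - int c + 1"
  proof (cases "v - c + 1 \<le> r")
    case le: True
    then have "(v - c + 1, False) \<in> {1..r} \<times> UNIV" by simp
    from bspec[OF cut(1)[unfolded good_cut_def] this] False
    have "stays T t False (int (v - c + 1)) \<omega> v" by simp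
    from stays_endpoint_less[OF this s m(1)] show ?thesis
      using False by (simp add: endpoint_orient displacement_def)
  next
    case gt: False
    then show ?thesis using abs_endpoint_le[of "moves \<omega> v m"] m(2) False by (simp add: displacement_def)
  qed
  then show ?thesis using False by simp
qed

text \<open>
  On the cover, a walker that starts outside of the arc \<open>{c..<c'}\<close> ends up at most \<open>r\<close> beyond the ends of
  \<open>{0..<n}\<close>. As both cuts are at least \<open>r\<close> away from these ends, it cannot enter the arc by going around.
\<close>

lemma two_good_cuts_separate:
  assumes ok: "choices_ok \<omega>" and few: "\<And>v. v \<in> V \<Longrightarrow> t < jump_time \<omega> v (Suc r)"
    and cut: "good_cut T r t c \<omega>" "good_cut T r t c' \<omega>"
    and c: "r \<le> c" "c < c'" "c' + r \<le> n"
    and v: "v \<in> V" and s: "0 \<le> s" "s \<le> t"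
  shows "position \<omega> v s \<in> {c..<c'} \<longleftrightarrow> v \<in> {c..<c'}"
proof -
  have vn: "v < n" using v by (simp add: cycle_vertices_def)
  have "s < jump_time \<omega> v (Suc r)" using few[OF v] s by simp
  then obtain m where m: "m \<le> r" "has_jumped \<omega> v s m" using has_jumpedE[OF s(1)] by blast
  define z where "z = int v + displacement \<omega> v m"
  have pos: "position \<omega> v s = vertex z"
    using position_has_jumped[OF m(2)] jump_chain_eq_vertex[OF ok v] by (simp add: z_def)
  have 1: "z < int c \<longleftrightarrow> v < c" "z < int c' \<longleftrightarrow> v < c'"
    unfolding z_def using good_cut_not_crossed[OF cut(1) _ s m(2,1)] good_cut_not_crossed[OF cut(2) _ s m(2,1)] c by auto
  have 2: "\<bar>z - int v\<bar> \<le> int r"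
    using abs_endpoint_le[of "moves \<omega> v m"] m(1) by (simp add: z_def displacement_def)
  consider "z < 0" | "0 \<le> z" "z < int n" | "int n \<le> z" by linarith
  then show ?thesis
  proof cases
    case 1
    have "z mod int n = z + int n"
      using 1 2 c n_ge_3 by (intro mod_pos_pos_trivial[of "z + int n" "int n", simplified]) auto
    then have "int (vertex z) = z + int n" by (simp add: int_vertex)
    then show ?thesis unfolding pos using 1 2 c \<open>z < int c \<longleftrightarrow> v < c\<close> by auto
  next
    case 2
    then have "int (vertex z) = z" by (simp add: int_vertex)
    then show ?thesis unfolding pos using 1 by auto
  next
    case 3
    have "z mod int n = (z - int n) mod int n" by simp
    also have "\<dots> = z - int n" using 3 2 c vn by (intro mod_pos_pos_trivial) auto
    finally have "int (vertex z) = z - int n" by (simp add: int_vertex)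
    then show ?thesis unfolding pos using 3 2 c vn \<open>z < int c' \<longleftrightarrow> v < c'\<close> by auto
  qed
qed

lemma separated_not_connected:
  assumes sep: "\<And>v s. v \<in> V \<Longrightarrow> 0 \<le> s \<Longrightarrow> s \<le> t \<Longrightarrow> position \<omega> v s \<in> A \<longleftrightarrow> v \<in> A"
    and ab: "a \<in> V" "a \<in> A" "b \<in> V" "b \<notin> A"
  shows "\<not> social_connectivity_time V \<omega> < ereal t"
proof
  assume "social_connectivity_time V \<omega> < ereal t"
  then obtain s where s: "s < t" "acquaintance_path V \<omega> s a b"
    unfolding social_connectivity_time_def using ab by (auto simp: Inf_less_iff)
  then obtain k c where c: "c 0 = a" "c (Suc k) = b" "\<forall>i\<le>Suc k. c i \<in> V" "\<forall>i\<le>k. met_by \<omega> s (c i) (c (Suc i))"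
    unfolding acquaintance_path_def by blast
  have "c i \<in> A" if "i \<le> Suc k" for i
    using that
  proof (induction i)
    case (Suc i)
    then obtain t0 where t0: "0 \<le> t0" "t0 \<le> s" "position \<omega> (c i) t0 = position \<omega> (c (Suc i)) t0"
      using c(4) unfolding met_by_def by auto
    then show ?case using sep[of "c i" t0] sep[of "c (Suc i)" t0] Suc c(3) s(1) by auto
  qed (use c ab in simp)
  then show False using c(2) ab(4) by blast
qed

section \<open>Events of a single walker\<close>

lemma jump_time_cong: "(\<And>j. \<omega> (v, j) = \<omega>' (v, j)) \<Longrightarrow> jump_time \<omega> v k = jump_time \<omega>' v k"
  by (simp add: jump_time_def)

lemma moves_cong:
  assumes "\<And>j. \<omega> (v, j) = \<omega>' (v, j)"
  shows "moves \<omega> v m = moves \<omega>' v m"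
proof -
  have "jump_chain \<omega> v k = jump_chain \<omega>' v k" for k using assms by (induction k) simp_all
  then show ?thesis by (simp add: moves_def went_up_def del: jump_chain.simps)
qed

lemma stays_cong: "(\<And>j. \<omega> (v, j) = \<omega>' (v, j)) \<Longrightarrow> stays T t b k \<omega> v = stays T t b k \<omega>' v"
  unfolding stays_def using jump_time_cong moves_cong by metis

lemma moved_cong: "(\<And>j. \<omega> (v, j) = \<omega>' (v, j)) \<Longrightarrow> moved t b d \<omega> v = moved t b d \<omega>' v"
  unfolding moved_def has_jumped_def using jump_time_cong[of \<omega> v \<omega>'] moves_cong[of \<omega> v \<omega>'] by simp

section \<open>Probability of late connection\<close>

text \<open>
  The distance required of \<open>g k\<close> is \<open>k + 1\<close>, that of the \<open>k\<close>-th walker from an edge to the far end of this edge.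
\<close>

lemma prob_none_moved:
  assumes inj: "inj_on g {..<L}" and g: "\<And>k. k < L \<Longrightarrow> g k \<in> V" and t: "32 * (real L)\<^sup>2 \<le> t"
  shows "\<P>(\<omega> in M. \<forall>k\<in>{..<L}. \<not> moved t b (Suc k) \<omega> (g k)) \<le> (31 / 32) ^ L"
proof -
  have "\<P>(\<omega> in M. \<forall>k\<in>{..<L}. \<not> moved t b (Suc k) \<omega> (g k)) =
      (\<Prod>k\<in>{..<L}. \<P>(\<omega> in M. \<not> moved t b (Suc k) \<omega> (g k)))"
  proof (rule prob_disjoint_walkers[where F = "\<lambda>k. {g k}"])
    show "disjoint_family_on (\<lambda>k. {g k}) {..<L}"
      using inj by (auto simp: disjoint_family_on_def inj_on_def)
    show "Measurable.pred (walkers_space {g k} E) (\<lambda>\<omega>. \<not> moved t b (Suc k) \<omega> (g k))" for k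
      by (intro pred_intros_logic measurable_moved) simp
    show "(\<not> moved t b (Suc k) \<omega> (g k)) = (\<not> moved t b (Suc k) \<omega>' (g k))"
      if "\<And>v j. v \<in> {g k} \<Longrightarrow> \<omega> (v, j) = \<omega>' (v, j)" for k \<omega> \<omega>'
      using moved_cong[of \<omega> "g k" \<omega>'] that by simp
  qed (use g in auto)
  also have "\<dots> \<le> (\<Prod>k\<in>{..<L}. 31 / 32)"
  proof (rule prod_mono, safe)
    fix k assume k: "k < L"
    have "(real (Suc k))\<^sup>2 \<le> (real L)\<^sup>2" using k by (intro power_mono) auto
    with t have "32 * (real (Suc k))\<^sup>2 \<le> t" by linarith
    then have "1 / 32 \<le> \<P>(\<omega> in M. moved t b (Suc k) \<omega> (g k))"
      by (intro prob_moved g k) auto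
    moreover have "{\<omega>\<in>space M. moved t b (Suc k) \<omega> (g k)} \<in> events"
      using measurable_moved[OF g[OF k]] by (simp add: pred_def)
    ultimately show "\<P>(\<omega> in M. \<not> moved t b (Suc k) \<omega> (g k)) \<le> 31 / 32"
      by (subst prob_neg) auto
  qed auto
  finally show ?thesis by simp
qed

lemma inj_on_vertex_interval: "b < a + int n \<Longrightarrow> inj_on vertex {a..b}"
proof (rule inj_onI)
  fix x y assume b: "b < a + int n" and xy: "x \<in> {a..b}" "y \<in> {a..b}" "vertex x = vertex y"
  then have "int n dvd x - y" by (simp add: vertex_eq_iff)
  moreover have "\<bar>x - y\<bar> < int n" using b xy by auto
  ultimately show "x = y" using zdvd_not_zless zdvd_imp_le by (metis abs_0_eq dvd_abs_iff eq_iff_diff_eq_0 zero_less_abs_iff abs_ge_zero linorder_not_less)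
qed

text \<open>
  Union bound over the edges and the two directions. That \<open>L \<le> n\<close> makes the \<open>L\<close> walkers on one side of an edge
  different, hence independent.
\<close>

lemma prob_social_connectivity_time_gt:
  assumes L: "L \<le> n" and t: "32 * (real L)\<^sup>2 \<le> t"
  shows "\<P>(\<omega> in M. ereal t < social_connectivity_time V \<omega>) \<le> 2 * real n * (31 / 32) ^ L"
proof -
  have t0: "0 \<le> t" using t by (smt (verit) zero_le_power2)
  define up where "up a k = vertex (int a - int k)" for a k :: nat
  define dn where "dn a k = vertex (int a + 1 + int k)" for a k :: nat
  define A where "A a = {\<omega>\<in>space M. \<forall>k\<in>{..<L}. \<not> moved t True (Suc k) \<omega> (up a k)}" for a
  define B where "B a = {\<omega>\<in>space M. \<forall>k\<in>{..<L}. \<not> moved t False (Suc k) \<omega> (dn a k)}" for a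
  have [measurable]: "Measurable.pred M (\<lambda>\<omega>. moved t b k \<omega> (up a j))"
    "Measurable.pred M (\<lambda>\<omega>. moved t b k \<omega> (dn a j))" for b k a j
    by (auto intro!: measurable_moved simp: up_def dn_def)
  have meas: "A a \<in> events" "B a \<in> events" for a
    unfolding A_def B_def by measurable
  have inj: "inj_on (up a) {..<L}" "inj_on (dn a) {..<L}" for a
  proof -
    have 1: "inj_on vertex {int a - int L + 1..int a}" and 2: "inj_on vertex {int a + 1..int a + int L}"
      using L by (intro inj_on_vertex_interval; simp)+
    show "inj_on (up a) {..<L}"
    proof (rule inj_onI)
      fix k l assume "k \<in> {..<L}" "l \<in> {..<L}" "up a k = up a l"
      then show "k = l" using inj_onD[OF 1, of "int a - int k" "int a - int l"] by (simp add: up_def)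
    qed
    show "inj_on (dn a) {..<L}"
    proof (rule inj_onI)
      fix k l assume "k \<in> {..<L}" "l \<in> {..<L}" "dn a k = dn a l"
      then show "k = l" using inj_onD[OF 2, of "int a + 1 + int k" "int a + 1 + int l"] by (simp add: dn_def)
    qed
  qed
  have A: "prob (A a) \<le> (31 / 32) ^ L" for a
    unfolding A_def by (rule prob_none_moved[OF inj(1) _ t]) (simp add: up_def)
  have B: "prob (B a) \<le> (31 / 32) ^ L" for a
    unfolding B_def by (rule prob_none_moved[OF inj(2) _ t]) (simp add: dn_def)
  have "\<P>(\<omega> in M. ereal t < social_connectivity_time V \<omega>) \<le> prob (\<Union>a\<in>{..<n}. A a \<union> B a)"
  proof (rule finite_measure_mono_AE)
    show "AE \<omega> in M. \<omega> \<in> {\<omega>\<in>space M. ereal t < social_connectivity_time V \<omega>} \<longrightarrow> \<omega> \<in> (\<Union>a\<in>{..<n}. A a \<union> B a)"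
      using AE_regular AE_jump_times_unbounded[of t]
    proof eventually_elim
      case (elim \<omega>)
      show ?case
      proof (rule impI, rule ccontr)
        assume late: "\<omega> \<in> {\<omega>\<in>space M. ereal t < social_connectivity_time V \<omega>}"
          and no: "\<omega> \<notin> (\<Union>a\<in>{..<n}. A a \<union> B a)"
        have unb: "\<exists>m. has_jumped \<omega> v t m" if "v \<in> V" for v
          using elim(2) that has_jumpedE[OF t0] by metis
        have "(vertex (int a), vertex (int a + 1)) \<in> (met_rel \<omega> t)\<^sup>+" if a: "a < n" for a
        proof -
          have "\<omega> \<notin> A a" "\<omega> \<notin> B a" using no a by blast+
          then obtain k l where "moved t True (Suc k) \<omega> (up a k)" "moved t False (Suc l) \<omega> (dn a l)"
            using late unfolding A_def B_def by auto
          then show ?thesis unfolding up_def dn_def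
            by (intro acquainted_across_edge[OF elim(1) t0 unb, of "int a - int k" _ "int a + 1 + int l" "Suc k" "Suc l"]) auto
        qed
        from social_connectivity_time_le[OF t0 this] show False using late by auto
      qed
    qed
    show "(\<Union>a\<in>{..<n}. A a \<union> B a) \<in> events" using meas by auto
  qed
  also have "\<dots> \<le> (\<Sum>a<n. prob (A a \<union> B a))"
    using meas by (intro finite_measure_subadditive_finite) auto
  also have "\<dots> \<le> (\<Sum>a<n. 2 * (31 / 32) ^ L)"
  proof (rule sum_mono)
    fix a
    have "prob (A a \<union> B a) \<le> prob (A a) + prob (B a)" using meas by (intro measure_Un_le) auto
    then show "prob (A a \<union> B a) \<le> 2 * (31 / 32) ^ L" using A[of a] B[of a] by simp
  qed
  also have "\<dots> = 2 * real n * (31 / 32) ^ L" by simp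
  finally show ?thesis .
qed

section \<open>Probability of early connection\<close>

lemma good_cut_local:
  assumes c: "r \<le> c" "\<And>v k. c - r \<le> v \<Longrightarrow> v < c + r \<Longrightarrow> \<omega> (v, k) = \<omega>' (v, k)"
  shows "good_cut T r t c \<omega> = good_cut T r t c \<omega>'"
proof -
  have "stays T t b (int k) \<omega> (if b then c - k else c + k - 1) = stays T t b (int k) \<omega>' (if b then c - k else c + k - 1)"
    if "k \<in> {1..r}" for b k
    using that c(1) by (intro stays_cong c(2)) auto
  then show ?thesis unfolding good_cut_def by auto
qed

lemma measurable_good_cut:
  assumes "r \<le> c" "{c - r..<c + r} \<subseteq> A"
  shows "Measurable.pred (walkers_space A E) (good_cut T r t c)"
proof -
  have "Measurable.pred (walkers_space A E) (\<lambda>\<omega>. \<forall>x\<in>{1..r} \<times> UNIV.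
      stays T t (snd x) (int (fst x)) \<omega> (if snd x then c - fst x else c + fst x - 1))"
  proof (intro pred_intros_finite measurable_stays)
    fix x :: "nat \<times> bool" assume "x \<in> {1..r} \<times> UNIV"
    then have "(if snd x then c - fst x else c + fst x - 1) \<in> {c - r..<c + r}" using assms(1) by auto
    with assms(2) show "(if snd x then c - fst x else c + fst x - 1) \<in> A" by blast
  qed simp
  also have "(\<lambda>\<omega>. \<forall>x\<in>{1..r} \<times> UNIV.
      stays T t (snd x) (int (fst x)) \<omega> (if snd x then c - fst x else c + fst x - 1)) = good_cut T r t c"
    unfolding good_cut_def by (simp add: fun_eq_iff case_prod_unfold)
  finally show ?thesis .
qed

text \<open>
  The \<open>2 r\<close> walkers are independent; the square of the product comes from the two sides of the gap.
\<close>

lemma prob_good_cut: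
  assumes c: "r \<le> c" "c + r \<le> n" and w: "1 \<le> w" and t: "0 \<le> t" "exp t / 2 ^ Suc (w\<^sup>2) \<le> 1"
  shows "\<P>(\<omega> in M. good_cut (w\<^sup>2) r t c \<omega>) \<ge> (1 - exp t / 2 ^ Suc (w\<^sup>2)) ^ (2 * r) * exp (- 30 * real w)"
proof -
  define \<rho> where "\<rho> = 1 - exp t / 2 ^ Suc (w\<^sup>2)"
  have \<rho>: "0 \<le> \<rho>" using t by (simp add: \<rho>_def)
  let ?v = "\<lambda>x :: nat \<times> bool. if snd x then c - fst x else c + fst x - 1"
  let ?I = "{1..r} \<times> (UNIV :: bool set)"
  have inV: "?v x \<in> V" if "x \<in> ?I" for x using that c by (auto simp: cycle_vertices_def)
  have "\<rho> ^ (2 * r) * exp (- 30 * real w) = \<rho> ^ (2 * r) * exp (- 15 * real w) ^ 2"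
    by (simp flip: exp_of_nat_mult)
  also have "\<dots> \<le> \<rho> ^ (2 * r) * (\<Prod>k=1..r. stay_prob (w\<^sup>2) (int k)) ^ 2"
    using prod_stay_prob_ge[OF w, of r] \<rho> by (intro mult_left_mono power_mono) auto
  also have "\<dots> = (\<Prod>x\<in>?I. \<rho> * stay_prob (w\<^sup>2) (int (fst x)))"
    by (simp add: prod.cartesian_product' UNIV_bool prod.distrib power_mult_distrib power2_eq_square power_mult
        mult_2 power_add ac_simps)
  also have "\<dots> \<le> (\<Prod>x\<in>?I. \<P>(\<omega> in M. stays (w\<^sup>2) t (snd x) (int (fst x)) \<omega> (?v x)))"
    unfolding \<rho>_def using \<rho> stay_prob_nonneg by (intro prod_mono conjI prob_stays inV t mult_nonneg_nonneg) (auto simp: \<rho>_def)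
  also have "\<dots> = \<P>(\<omega> in M. \<forall>x\<in>?I. stays (w\<^sup>2) t (snd x) (int (fst x)) \<omega> (?v x))"
  proof (rule prob_disjoint_walkers[symmetric, where F = "\<lambda>x. {?v x}"])
    show "disjoint_family_on (\<lambda>x. {?v x}) ?I"
      using c by (auto simp: disjoint_family_on_def)
    show "Measurable.pred (walkers_space {?v x} E) (\<lambda>\<omega>. stays (w\<^sup>2) t (snd x) (int (fst x)) \<omega> (?v x))" for x
      by (rule measurable_stays) simp
    show "stays (w\<^sup>2) t (snd x) (int (fst x)) \<omega> (?v x) = stays (w\<^sup>2) t (snd x) (int (fst x)) \<omega>' (?v x)"
      if "\<And>v j. v \<in> {?v x} \<Longrightarrow> \<omega> (v, j) = \<omega>' (v, j)" for x \<omega> \<omega>'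
      using that by (intro stays_cong) auto
  qed (use inV in auto)
  also have "\<dots> = \<P>(\<omega> in M. good_cut (w\<^sup>2) r t c \<omega>)"
    unfolding good_cut_def by (simp only: case_prod_unfold)
  finally show ?thesis by (simp add: \<rho>_def)
qed

text \<open>
  The windows \<open>[2 r b, 2 r b + 2 r)\<close> around the gaps are disjoint, so the cuts are independent.
\<close>

lemma prob_no_good_cut:
  assumes r: "2 * r * (a + q) \<le> n"
    and p: "\<And>c. r \<le> c \<Longrightarrow> c + r \<le> n \<Longrightarrow> p \<le> \<P>(\<omega> in M. good_cut T r t c \<omega>)"
  shows "\<P>(\<omega> in M. \<forall>b\<in>{a..<a + q}. \<not> good_cut T r t (2 * r * b + r) \<omega>) \<le> (1 - p) ^ q"
proof -
  let ?F = "\<lambda>b. {2 * r * b..<2 * r * b + 2 * r}"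
  have top: "2 * r * b + 2 * r \<le> n" if "b \<in> {a..<a + q}" for b
  proof -
    have "2 * r * Suc b \<le> 2 * r * (a + q)" using that by (intro mult_left_mono) auto
    then show ?thesis using r by simp
  qed
  have sub: "?F b \<subseteq> V" if "b \<in> {a..<a + q}" for b
    using top[OF that] by (auto simp: cycle_vertices_def)
  have win: "{2 * r * b + r - r..<2 * r * b + r + r} = ?F b" for b by auto
  have "\<P>(\<omega> in M. \<forall>b\<in>{a..<a + q}. \<not> good_cut T r t (2 * r * b + r) \<omega>) =
      (\<Prod>b\<in>{a..<a + q}. \<P>(\<omega> in M. \<not> good_cut T r t (2 * r * b + r) \<omega>))"
  proof (rule prob_disjoint_walkers[where F = ?F])
    have "?F b \<inter> ?F b' = {}" if "b < b'" for b b'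
    proof -
      have "2 * r * Suc b \<le> 2 * r * b'" using that by (intro mult_left_mono) auto
      then show ?thesis by auto
    qed
    then show "disjoint_family_on ?F {a..<a + q}"
      unfolding disjoint_family_on_def by (metis inf_commute linorder_neqE_nat)
    show "Measurable.pred (walkers_space (?F b) E) (\<lambda>\<omega>. \<not> good_cut T r t (2 * r * b + r) \<omega>)" for b
      by (intro pred_intros_logic measurable_good_cut) auto
    show "(\<not> good_cut T r t (2 * r * b + r) \<omega>) = (\<not> good_cut T r t (2 * r * b + r) \<omega>')"
      if "\<And>v j. v \<in> ?F b \<Longrightarrow> \<omega> (v, j) = \<omega>' (v, j)" for b \<omega> \<omega>'
      using good_cut_local[of r "2 * r * b + r" \<omega> \<omega>' T t] that by auto
  qed (use sub in auto)
  also have "\<dots> \<le> (\<Prod>b\<in>{a..<a + q}. 1 - p)"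
  proof (rule prod_mono, rule conjI)
    fix b assume b: "b \<in> {a..<a + q}"
    have "{\<omega>\<in>space M. good_cut T r t (2 * r * b + r) \<omega>} \<in> events"
      using measurable_good_cut[of r "2 * r * b + r" V T t] sub[OF b] win[of b] by (simp add: pred_def)
    then have "\<P>(\<omega> in M. \<not> good_cut T r t (2 * r * b + r) \<omega>) = 1 - \<P>(\<omega> in M. good_cut T r t (2 * r * b + r) \<omega>)"
      by (rule prob_neg)
    also have "\<dots> \<le> 1 - p" using p[of "2 * r * b + r"] top[OF b] by simp
    finally show "\<P>(\<omega> in M. \<not> good_cut T r t (2 * r * b + r) \<omega>) \<le> 1 - p" .
  qed auto
  finally show ?thesis by simp
qed

text \<open>
  There are \<open>2 q\<close> disjoint windows. If both the first \<open>q\<close> and the last \<open>q\<close> of them contain a good cut, and no walker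
  makes more than \<open>r\<close> jumps, then the two cuts disconnect the walkers.
\<close>

lemma prob_social_connectivity_time_less:
  assumes r: "1 \<le> r" "2 * r * (2 * q) \<le> n" and w: "1 \<le> w" and t: "0 \<le> t" "exp t / 2 ^ Suc (w\<^sup>2) \<le> 1"
  defines "p \<equiv> (1 - exp t / 2 ^ Suc (w\<^sup>2)) ^ (2 * r) * exp (- 30 * real w)"
  shows "\<P>(\<omega> in M. social_connectivity_time V \<omega> < ereal t) \<le> 2 * (1 - p) ^ q + real n * (exp t / 2 ^ Suc r)"
proof -
  let ?G = "\<lambda>a. {\<omega>\<in>space M. \<forall>b\<in>{a..<a + q}. \<not> good_cut (w\<^sup>2) r t (2 * r * b + r) \<omega>}"
  let ?J = "\<lambda>v. {\<omega>\<in>space M. jump_time \<omega> v (Suc r) \<le> t}"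
  have top: "2 * r * b + 2 * r \<le> n" if "b < 2 * q" for b
  proof -
    have "2 * r * Suc b \<le> 2 * r * (2 * q)" using that by (intro mult_left_mono) auto
    then show ?thesis using r by simp
  qed
  have G: "?G a \<in> events" if "a + q \<le> 2 * q" for a
  proof -
    have "Measurable.pred M (\<lambda>\<omega>. \<forall>b\<in>{a..<a + q}. \<not> good_cut (w\<^sup>2) r t (2 * r * b + r) \<omega>)"
    proof (intro pred_intros_finite pred_intros_logic measurable_good_cut)
      fix b assume "b \<in> {a..<a + q}"
      then show "{2 * r * b + r - r..<2 * r * b + r + r} \<subseteq> V"
        using top[of b] that by (auto simp: cycle_vertices_def)
    qed auto
    then show ?thesis by (simp add: pred_def)
  qed
  have J: "?J v \<in> events" if "v \<in> V" for v
  proof -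
    note [measurable] = measurable_jump_time[OF that]
    show ?thesis by measurable
  qed
  have PG: "prob (?G a) \<le> (1 - p) ^ q" if "a + q \<le> 2 * q" for a
  proof (rule prob_no_good_cut)
    have "2 * r * (a + q) \<le> 2 * r * (2 * q)" using that by (intro mult_left_mono) auto
    then show "2 * r * (a + q) \<le> n" using r by linarith
  qed (unfold p_def, intro prob_good_cut w t)
  have "\<P>(\<omega> in M. social_connectivity_time V \<omega> < ereal t) \<le> prob ((?G 0 \<union> ?G q) \<union> (\<Union>v\<in>V. ?J v))"
  proof (rule finite_measure_mono_AE)
    show "AE \<omega> in M. \<omega> \<in> {\<omega>\<in>space M. social_connectivity_time V \<omega> < ereal t} \<longrightarrow> \<omega> \<in> (?G 0 \<union> ?G q) \<union> (\<Union>v\<in>V. ?J v)"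
      using AE_choices_ok
    proof eventually_elim
      case (elim \<omega>)
      show ?case
      proof (rule impI, rule ccontr)
        assume early: "\<omega> \<in> {\<omega>\<in>space M. social_connectivity_time V \<omega> < ereal t}"
          and no: "\<omega> \<notin> (?G 0 \<union> ?G q) \<union> (\<Union>v\<in>V. ?J v)"
        obtain b where b: "b < q" "good_cut (w\<^sup>2) r t (2 * r * b + r) \<omega>"
          using no early by auto
        obtain b' where b': "q \<le> b'" "b' < 2 * q" "good_cut (w\<^sup>2) r t (2 * r * b' + r) \<omega>"
          using no early by auto
        define c c' where "c = 2 * r * b + r" and "c' = 2 * r * b' + r"
        have c: "r \<le> c" "c < c'" "c' + r \<le> n"
          using b b' r top[of b'] by (auto simp: c_def c'_def)
        have sep: "position \<omega> v s \<in> {c..<c'} \<longleftrightarrow> v \<in> {c..<c'}" if "v \<in> V" "0 \<le> s" "s \<le> t" for v s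
        proof (rule two_good_cuts_separate[OF elim _ _ _ c that])
          show "t < jump_time \<omega> v (Suc r)" if "v \<in> V" for v using no early that by (auto simp: not_le)
        qed (use b b' in \<open>simp_all add: c_def c'_def\<close>)
        have "\<not> social_connectivity_time V \<omega> < ereal t"
          by (rule separated_not_connected[OF sep, where a = c and b = 0]) (use c r(1) in \<open>auto simp: cycle_vertices_def\<close>)
        then show False using early by simp
      qed
    qed
    show "(?G 0 \<union> ?G q) \<union> (\<Union>v\<in>V. ?J v) \<in> events"
      by (intro sets.Un sets.finite_UN G J finite_V) auto
  qed
  also have "\<dots> \<le> prob (?G 0 \<union> ?G q) + prob (\<Union>v\<in>V. ?J v)"
    by (intro measure_Un_le sets.Un sets.finite_UN G J finite_V) auto
  also have "prob (?G 0 \<union> ?G q) \<le> prob (?G 0) + prob (?G q)"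
    by (intro measure_Un_le G) auto
  also have "prob (?G 0) \<le> (1 - p) ^ q" by (rule PG) simp
  also have "prob (?G q) \<le> (1 - p) ^ q" by (rule PG) simp
  also have "prob (\<Union>v\<in>V. ?J v) \<le> (\<Sum>v\<in>V. prob (?J v))"
    using J by (intro finite_measure_subadditive_finite) auto
  also have "\<dots> \<le> (\<Sum>v\<in>V. exp t / 2 ^ Suc r)"
    by (intro sum_mono prob_jump_time_le t)
  finally show ?thesis by (simp add: cycle_vertices_def)
qed

text \<open>
  With positive probability no walker jumps before time \<open>t\<close>.
\<close>

lemma prob_social_connectivity_time_less_1:
  assumes t: "0 \<le> t"
  shows "\<P>(\<omega> in M. social_connectivity_time V \<omega> < ereal t) < 1"
proof -
  let ?N = "{\<omega>\<in>space M. \<forall>v\<in>V. t < jump_time \<omega> v 1}"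
  have "prob ?N = (\<Prod>v\<in>V. \<P>(\<omega> in M. t < jump_time \<omega> v 1))"
  proof (rule prob_disjoint_walkers[where F = "\<lambda>v. {v}"])
    show "Measurable.pred (walkers_space {v} E) (\<lambda>\<omega>. t < jump_time \<omega> v 1)" for v
    proof -
      note [measurable] = measurable_jump_time[of v "{v}"]
      show ?thesis by measurable
    qed
  qed (auto simp: disjoint_family_on_def jump_time_def)
  also have "\<dots> = (\<Prod>v\<in>V. exp (- t))" by (intro prod.cong refl prob_first_jump_gt t)
  finally have pos: "0 < prob ?N" by (simp add: prod_pos)
  have N: "?N \<in> events"
  proof -
    have "Measurable.pred M (\<lambda>\<omega>. \<forall>v\<in>V. t < jump_time \<omega> v 1)"
      by (intro pred_intros_finite borel_measurable_pred_less measurable_jump_time) auto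
    then show ?thesis by (simp add: pred_def)
  qed
  have "\<P>(\<omega> in M. social_connectivity_time V \<omega> < ereal t) \<le> prob (space M - ?N)"
  proof (rule finite_measure_mono)
    show "{\<omega>\<in>space M. social_connectivity_time V \<omega> < ereal t} \<subseteq> space M - ?N"
    proof safe
      fix \<omega> assume early: "social_connectivity_time V \<omega> < ereal t" and N: "\<forall>v\<in>V. t < jump_time \<omega> v 1"
      have sep: "position \<omega> v s \<in> {0} \<longleftrightarrow> v \<in> {0}" if v: "v \<in> V" and s: "0 \<le> s" "s \<le> t" for v s
      proof -
        have "has_jumped \<omega> v s 0" using N v s by (auto simp: has_jumped_def jump_time_def)
        then show ?thesis using position_has_jumped by force
      qed
      have "\<not> social_connectivity_time V \<omega> < ereal t"
        by (rule separated_not_connected[OF sep, where a = 0 and b = 1]) (use n_ge_3 in \<open>auto simp: cycle_vertices_def\<close>)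
      then show False using early by simp
    qed
  qed (use N in auto)
  also have "\<dots> = 1 - prob ?N" using N by (rule prob_compl)
  finally show ?thesis using pos by simp
qed

end

section \<open>The two bounds as the cycle grows\<close>

text \<open>
  Finitely many values below 1 are at most some \<open>\<delta> < 1\<close>, and a small enough constant makes the exponential at least
  \<open>\<delta>\<close> at all of them. The added 1 in the denominator of \<open>c'\<close> only guards against \<open>N = 0\<close>.
\<close>

lemma exp_bound_from_eventually:
  fixes f :: "nat \<Rightarrow> real"
  assumes ev: "eventually (\<lambda>n. f n \<le> exp (- c * real n powr \<alpha>)) sequentially"
    and c: "0 < c" and \<alpha>: "0 < \<alpha>" and less: "\<And>n. k \<le> n \<Longrightarrow> f n < 1"
  shows "\<exists>c'>0. \<forall>n\<ge>k. f n \<le> exp (- c' * real n powr \<alpha>)"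
proof -
  obtain N where N: "\<And>n. N \<le> n \<Longrightarrow> f n \<le> exp (- c * real n powr \<alpha>)"
    using ev unfolding eventually_sequentially by blast
  define \<delta> where "\<delta> = Max (insert (1 / 2) (f ` {k..<N}))"
  have \<delta>: "1 / 2 \<le> \<delta>" and f\<delta>: "\<And>n. n \<in> {k..<N} \<Longrightarrow> f n \<le> \<delta>"
    unfolding \<delta>_def by (intro Max_ge; simp)+
  have "\<delta> < 1" unfolding \<delta>_def using less by (subst Max_less_iff) auto
  note \<delta> = \<delta> this
  define c' where "c' = min c (- ln \<delta> / (1 + real N powr \<alpha>))"
  have lnd: "0 < - ln \<delta>" using \<delta> by (simp add: ln_less_zero)
  have pos: "0 < 1 + real N powr \<alpha>" by (smt (verit) powr_ge_zero)
  then have c': "0 < c'" "c' \<le> c" "c' \<le> - ln \<delta> / (1 + real N powr \<alpha>)"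
    using c lnd by (auto simp: c'_def intro: divide_neg_pos)
  have "f n \<le> exp (- c' * real n powr \<alpha>)" if n: "k \<le> n" for n
  proof (cases "n < N")
    case True
    then have "real n powr \<alpha> \<le> real N powr \<alpha>" using \<alpha> by (intro powr_mono2) auto
    then have "c' * real n powr \<alpha> \<le> c' * (1 + real N powr \<alpha>)" using c' by (intro mult_left_mono) auto
    also have "\<dots> \<le> - ln \<delta>" using c'(3) pos by (simp only: pos_le_divide_eq)
    finally have "exp (ln \<delta>) \<le> exp (- c' * real n powr \<alpha>)" by simp
    moreover have "exp (ln \<delta>) = \<delta>" using \<delta> by simp
    ultimately show ?thesis using f\<delta>[of n] n True by simp
  next
    case False
    then have "f n \<le> exp (- c * real n powr \<alpha>)" by (intro N) simp
    also have "\<dots> \<le> exp (- c' * real n powr \<alpha>)" using c' by (simp add: mult_right_mono)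
    finally show ?thesis .
  qed
  then show ?thesis using c' by blast
qed

text \<open>
  The inequalities under which the parameters of \<open>prob_early_connection\<close> below are admissible and its bound has
  the claimed form.
\<close>

lemma early_connection_asymptotics:
  "eventually (\<lambda>x :: real. 240 \<le> ln x \<and> 2 * sqrt x * exp (- ((ln x)\<^sup>2 / 230400)) \<le> 1 / 2 \<and>
    2 * exp (- ((x powr (- (1 / 4)) / 2) * (sqrt x / 4 - 1))) + x * exp ((ln x)\<^sup>2 / 230400) * 2 powr (- sqrt x)
      \<le> exp (- (1 / 16) * x powr (1 / 4))) at_top"
  by (intro eventually_conj; real_asymp)

lemma late_connection_asymptotics: "eventually (\<lambda>x :: real. 65 * ln x \<le> x \<and> 1 \<le> ln x) at_top"
  by (intro eventually_conj; real_asymp)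


text \<open>
  Take \<open>L = \<lceil>64 log n\<rceil>\<close>, so that \<open>(31 / 32)\<^sup>L \<le> n\<^sup>-\<^sup>2\<close>. As \<open>L \<le> 65 log n\<close>, the condition \<open>32 L\<^sup>2 \<le> t\<close> holds with the constant
  \<open>135200 = 32 \<cdot> 65\<^sup>2\<close>. The summand \<open>N\<close> in \<open>C2\<close> covers the small \<open>n\<close>, for which the bound is at least 1.
\<close>

lemma late_connection:
  "\<exists>C2>0. \<forall>n\<ge>3. \<P>(\<omega> in walkers_space (cycle_vertices n) (cycle_edges n).
      social_connectivity_time (cycle_vertices n) \<omega> > ereal (135200 * (ln (real n))\<^sup>2)) \<le> C2 / real n"
proof -
  have "eventually (\<lambda>n. 65 * ln (real n) \<le> real n \<and> 1 \<le> ln (real n)) sequentially"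
    by (rule eventually_compose_filterlim[OF late_connection_asymptotics filterlim_real_sequentially])
  then obtain N where N: "\<And>n. N \<le> n \<Longrightarrow> 65 * ln (real n) \<le> real n \<and> 1 \<le> ln (real n)"
    unfolding eventually_sequentially by blast
  show ?thesis
  proof (intro exI[of _ "2 + real N"] conjI allI impI)
    fix n :: nat assume n: "3 \<le> n"
    interpret cycle_walkers n by unfold_locales (fact n)
    define t where "t = 135200 * (ln (real n))\<^sup>2"
    have "\<P>(\<omega> in M. ereal t < social_connectivity_time V \<omega>) \<le> (2 + real N) / real n"
    proof (cases "N \<le> n")
      case False
      have "\<P>(\<omega> in M. ereal t < social_connectivity_time V \<omega>) \<le> 1" by (rule prob_le_1)
      also have "\<dots> \<le> (2 + real N) / real n" using False n by (simp add: field_simps)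
      finally show ?thesis .
    next
      case True
      define L where "L = nat \<lceil>64 * ln (real n)\<rceil>"
      have ln1: "1 \<le> ln (real n)" and ln65: "65 * ln (real n) \<le> real n" using N[OF True] by auto
      have "64 * ln (real n) \<le> real L" unfolding L_def by (rule real_nat_ceiling_ge)
      moreover have "real L \<le> 64 * ln (real n) + 1" unfolding L_def using ln1 by linarith
      ultimately have L: "64 * ln (real n) \<le> real L" "real L \<le> 65 * ln (real n)" using ln1 by auto
      have "real L \<le> real n" using L ln65 by linarith
      then have Ln: "L \<le> n" by simp
      have "(real L)\<^sup>2 \<le> (65 * ln (real n))\<^sup>2" using L by (intro power_mono) auto
      then have t: "32 * (real L)\<^sup>2 \<le> t" by (simp add: t_def power_mult_distrib)
      have "(31 / 32 :: real) ^ L \<le> exp (- (1 / 32)) ^ L"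
        using exp_ge_add_one_self[of "- (1 / 32)"] by (intro power_mono) auto
      also have "\<dots> = exp (- (real L / 32))" by (simp flip: exp_of_nat_mult)
      also have "\<dots> \<le> exp (- (2 * ln (real n)))" using L by simp
      also have "\<dots> = 1 / (real n)\<^sup>2"
        using n by (simp add: exp_minus exp_double inverse_eq_divide)
      finally have small: "(31 / 32 :: real) ^ L \<le> 1 / (real n)\<^sup>2" .
      have "\<P>(\<omega> in M. ereal t < social_connectivity_time V \<omega>) \<le> 2 * real n * (31 / 32) ^ L"
        by (rule prob_social_connectivity_time_gt[OF Ln t])
      also have "\<dots> \<le> 2 * real n * (1 / (real n)\<^sup>2)" by (intro mult_left_mono small) auto
      also have "\<dots> = 2 / real n" by (simp add: power2_eq_square)
      also have "\<dots> \<le> (2 + real N) / real n" by (intro divide_right_mono) auto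
      finally show ?thesis .
    qed
    then show "\<P>(\<omega> in M. ereal (135200 * (ln (real n))\<^sup>2) < social_connectivity_time V \<omega>) \<le> (2 + real N) / real n"
      by (simp add: t_def)
  qed simp
qed

text \<open>
  With \<open>w = \<lfloor>log n / 120\<rfloor>\<close>, the two factors \<open>exp (-15 w)\<close> of a good cut together cost at most \<open>n powr (-1/4)\<close>. The
  constant \<open>230400 = 4 \<cdot> 240\<^sup>2\<close> makes \<open>t\<close> so small compared with \<open>w\<^sup>2\<close> that more than \<open>w\<^sup>2\<close> jumps have probability
  at most \<open>exp (- t)\<close>, which is negligible even for \<open>2 r\<close> walkers with \<open>r = \<lfloor>sqrt n\<rfloor>\<close>.
\<close>

lemma (in cycle_walkers) prob_early_connection:
  assumes ln: "240 \<le> ln (real n)"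
    and half: "2 * sqrt n * exp (- ((ln (real n))\<^sup>2 / 230400)) \<le> 1 / 2"
  shows "\<P>(\<omega> in M. social_connectivity_time V \<omega> < ereal ((ln (real n))\<^sup>2 / 230400)) \<le>
     2 * exp (- ((real n powr (- (1 / 4)) / 2) * (sqrt n / 4 - 1))) + n * exp ((ln (real n))\<^sup>2 / 230400) * 2 powr (- sqrt n)"
proof -
  define t where "t = (ln (real n))\<^sup>2 / 230400"
  define w where "w = nat \<lfloor>ln (real n) / 120\<rfloor>"
  define r where "r = nat \<lfloor>sqrt n\<rfloor>"
  define q where "q = n div (4 * r)"
  have t: "0 \<le> t" by (simp add: t_def)
  have "real w \<le> ln (real n) / 120" "ln (real n) / 120 - 1 \<le> real w"
    using ln unfolding w_def by linarith+
  then have w: "30 * real w \<le> ln (real n) / 4" "ln (real n) / 240 \<le> real w" using ln by auto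
  then have w1: "1 \<le> w" using ln by linarith
  have sq: "1 \<le> sqrt n" using n_ge_3 by simp
  have r: "real r \<le> sqrt n" "sqrt n - 1 \<le> real r" using sq unfolding r_def by linarith+
  have r1: "1 \<le> r" using sq unfolding r_def by linarith
  have rq: "2 * r * (2 * q) \<le> n"
    using div_times_less_eq_dividend[of n "4 * r"] by (simp add: q_def algebra_simps)
  have q: "sqrt n / 4 - 1 \<le> real q"
  proof -
    have "\<lfloor>real n / real (4 * r)\<rfloor> = int q" unfolding q_def by (rule floor_divide_of_nat_eq)
    then have "real n / real (4 * r) - 1 \<le> real q" by linarith
    moreover have "sqrt n / 4 \<le> real n / real (4 * r)"
    proof -
      have "sqrt n * real r \<le> sqrt n * sqrt n" using r by (intro mult_left_mono) auto
      also have "sqrt n * sqrt n = real n" by simp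
      finally show ?thesis using r1 by (simp add: field_simps)
    qed
    ultimately show ?thesis by linarith
  qed
  have late: "exp t / 2 ^ Suc (w\<^sup>2) \<le> exp (- t)"
  proof -
    have "(ln (real n) / 240)\<^sup>2 \<le> (real w)\<^sup>2" using w ln by (intro power_mono) auto
    then have "2 * t \<le> real (w\<^sup>2) / 2" by (simp add: t_def power_divide)
    then have "exp (2 * t) \<le> exp (real (w\<^sup>2) * (1 / 2))" by simp
    also have "\<dots> = exp (1 / 2) ^ (w\<^sup>2)" by (rule exp_of_nat_mult)
    also have "\<dots> \<le> 2 ^ (w\<^sup>2)" using exp_half_le2 by (intro power_mono) auto
    also have "\<dots> \<le> 2 ^ Suc (w\<^sup>2)" by simp
    finally have "exp t * exp t \<le> 2 ^ Suc (w\<^sup>2)" by (simp flip: exp_add)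
    then show ?thesis by (simp add: exp_minus field_simps)
  qed
  also have "exp (- t) \<le> 1" using t by simp
  finally have le1: "exp t / 2 ^ Suc (w\<^sup>2) \<le> 1" .
  define p where "p = (1 - exp t / 2 ^ Suc (w\<^sup>2)) ^ (2 * r) * exp (- 30 * real w)"
  have p: "real n powr (- (1 / 4)) / 2 \<le> p"
  proof -
    have "1 / 2 \<le> 1 - 2 * sqrt n * exp (- t)" using half by (simp add: t_def)
    also have "\<dots> \<le> 1 - real (2 * r) * exp (- t)" using r by (simp add: mult_right_mono)
    also have "\<dots> \<le> (1 - exp (- t)) ^ (2 * r)"
      using Bernoulli_inequality[of "- exp (- t)" "2 * r"] t by simp
    also have "\<dots> \<le> (1 - exp t / 2 ^ Suc (w\<^sup>2)) ^ (2 * r)" using late t by (intro power_mono) auto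
    finally have 1: "1 / 2 \<le> (1 - exp t / 2 ^ Suc (w\<^sup>2)) ^ (2 * r)" .
    have "real n powr (- (1 / 4)) = exp (- (ln (real n) / 4))" using n_ge_3 by (simp add: powr_def)
    also have "\<dots> \<le> exp (- 30 * real w)" using w by simp
    finally have 2: "real n powr (- (1 / 4)) \<le> exp (- 30 * real w)" .
    have "1 / 2 * real n powr (- (1 / 4)) \<le> p" unfolding p_def using 1 2 by (intro mult_mono) auto
    then show ?thesis by simp
  qed
  have p1: "p \<le> 1"
    unfolding p_def using le1 by (intro mult_le_one power_le_one) auto
  have "\<P>(\<omega> in M. social_connectivity_time V \<omega> < ereal t) \<le> 2 * (1 - p) ^ q + real n * (exp t / 2 ^ Suc r)"
    unfolding p_def by (rule prob_social_connectivity_time_less[OF r1 rq w1 t le1])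
  also have "\<dots> \<le> 2 * exp (- ((real n powr (- (1 / 4)) / 2) * (sqrt n / 4 - 1))) + n * exp t * 2 powr (- sqrt n)"
  proof (rule add_mono)
    have "(1 - p) ^ q \<le> exp (- p) ^ q" using exp_ge_add_one_self[of "- p"] p1 by (intro power_mono) auto
    also have "\<dots> = exp (- (p * real q))" by (simp flip: exp_of_nat_mult add: mult.commute)
    also have "\<dots> \<le> exp (- ((real n powr (- (1 / 4)) / 2) * (sqrt n / 4 - 1)))"
    proof -
      have "(real n powr (- (1 / 4)) / 2) * (sqrt n / 4 - 1) \<le> (real n powr (- (1 / 4)) / 2) * real q"
        using q by (intro mult_left_mono) auto
      also have "\<dots> \<le> p * real q" using p by (intro mult_right_mono) auto
      finally show ?thesis by simp
    qed
    finally show "2 * (1 - p) ^ q \<le> 2 * exp (- ((real n powr (- (1 / 4)) / 2) * (sqrt n / 4 - 1)))" by simp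
    have "2 powr sqrt n \<le> 2 powr real (Suc r)" using r by (intro powr_mono) auto
    then have "2 powr sqrt n \<le> 2 ^ Suc r" by (simp only: powr_realpow zero_less_numeral)
    then have "exp t / 2 ^ Suc r \<le> exp t / 2 powr sqrt n" by (intro divide_left_mono) auto
    then have "real n * (exp t / 2 ^ Suc r) \<le> real n * (exp t / 2 powr sqrt n)" by (intro mult_left_mono) auto
    then show "real n * (exp t / 2 ^ Suc r) \<le> n * exp t * 2 powr (- sqrt n)"
      by (simp add: powr_minus field_simps)
  qed
  finally show ?thesis by (simp add: t_def)
qed

lemma early_connection:
  "\<exists>c2>0. \<forall>n\<ge>3. \<P>(\<omega> in walkers_space (cycle_vertices n) (cycle_edges n).
      social_connectivity_time (cycle_vertices n) \<omega> < ereal (1 / 230400 * (ln (real n))\<^sup>2))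
      \<le> exp (- c2 * real n powr (1 / 4))"
proof (rule exp_bound_from_eventually[where c = "1 / 16"])
  show "eventually (\<lambda>n. \<P>(\<omega> in walkers_space (cycle_vertices n) (cycle_edges n).
      social_connectivity_time (cycle_vertices n) \<omega> < ereal (1 / 230400 * (ln (real n))\<^sup>2))
      \<le> exp (- (1 / 16) * real n powr (1 / 4))) sequentially"
    using eventually_compose_filterlim[OF early_connection_asymptotics filterlim_real_sequentially]
      eventually_ge_at_top[of 3]
  proof eventually_elim
    case (elim n)
    interpret cycle_walkers n by unfold_locales (fact elim)
    show ?case using prob_early_connection elim(1) by simp
  qed
  fix n :: nat assume n: "3 \<le> n"
  interpret cycle_walkers n by unfold_locales (fact n)
  show "\<P>(\<omega> in M. social_connectivity_time V \<omega> < ereal (1 / 230400 * (ln (real n))\<^sup>2)) < 1"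
    by (rule prob_social_connectivity_time_less_1) simp
qed simp_all

theorem theorem3:
  shows "\<exists>c1 c2 \<alpha> C1 C2 :: real. c1 > 0 \<and> c2 > 0 \<and> \<alpha> > 0 \<and> C1 > 0 \<and> C2 > 0 \<and>
    (\<forall>n::nat. n \<ge> 3 \<longrightarrow>
      \<P>(\<omega> in walkers_space (cycle_vertices n) (cycle_edges n).
          social_connectivity_time (cycle_vertices n) \<omega> > ereal (C1 * (ln (real n))\<^sup>2))
        \<le> C2 / real n \<and>
      \<P>(\<omega> in walkers_space (cycle_vertices n) (cycle_edges n).
          social_connectivity_time (cycle_vertices n) \<omega> < ereal (c1 * (ln (real n))\<^sup>2))
        \<le> exp (- c2 * real n powr \<alpha>))"
proof -
  obtain C2 :: real where C2: "0 < C2"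
    "\<forall>n\<ge>3. \<P>(\<omega> in walkers_space (cycle_vertices n) (cycle_edges n).
      social_connectivity_time (cycle_vertices n) \<omega> > ereal (135200 * (ln (real n))\<^sup>2)) \<le> C2 / real n"
    using late_connection by blast
  obtain c2 :: real where c2: "0 < c2"
    "\<forall>n\<ge>3. \<P>(\<omega> in walkers_space (cycle_vertices n) (cycle_edges n).
      social_connectivity_time (cycle_vertices n) \<omega> < ereal (1 / 230400 * (ln (real n))\<^sup>2))
      \<le> exp (- c2 * real n powr (1 / 4))"
    using early_connection by blast
  show ?thesis
    by (rule exI[of _ "1 / 230400"], rule exI[of _ c2], rule exI[of _ "1 / 4"], rule exI[of _ 135200], rule exI[of _ C2])
       (use C2 c2 in auto)
qed

end
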